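(* Let $\rho\in\mathcal P(\mathbb T^d)$ and $t\le T$, and let $(\rho_s(\cdot),\Phi_s(\cdot))$, $s\in[t,T]$, be a classical solution of the mean field game (MFG) system $$\partial_s\rho_s(x)+\nabla\cdot\big(\rho_s(x)\,\partial_pH(x,\nabla\Phi_s(x))\big)=0,\qquad \partial_s\Phi_s(x)+H(x,\nabla\Phi_s(x))+F(x,\rho_s)=0,\qquad t\le s\le T,$$ $$\rho_t(x)=\rho(x),\qquad \Phi_T(x)=G(x,\rho_T).$$ Suppose $u(x,\rho,t)$ is a classical solution of the master equation $$\partial_tu(x,\rho,t)+H(x,\nabla_xu(x,\rho,t))+F(x,\rho)+\int_{\mathbb T^d} D_pH(y,\nabla_yu(y,\rho,t))\cdot\nabla_y\Big[\frac{\delta u}{\delta\rho}(x,\rho,y,t)\Big]\rho(y)\,dy=0,\quad t\le T,$$ $$u(x,\rho,T)=G(x,\rho).$$ Assume moreover that, for a given forcing term $R(x,s)$, the classical solution $\Psi(x,s)$ of the nonlocal Hamilton–Jacobi equation $$\partial_s\Psi(x,s)+H(x,\nabla_x\Psi(x,s))+\int_{\mathbb T^d} D_pH(y,\nabla_y\Psi(y,s))\cdot\nabla_y\Big[\frac{\delta u}{\delta\rho}(x,\rho_s,y,s)\Big]\rho_s(y)\,dy=R(x,s),\qquad \Psi(x,T)=G(x,\rho_T),$$ is unique. Then $u(x,\rho,t)$ can be expressed as the value function $$u(x,\rho,t)=\sup_{v_s,\,x_s}\Big(G(x_T,\rho_T)-\int_t^T\big(L(x_s,v_s)-F(x_s,\rho_s)\big)\,ds\Big),$$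 where the supremum is over curves with $\dot x_s=v_s$, $t\le s\le T$, $x_t=x$, and where $(\rho_s(\cdot),\Phi_s(\cdot))$, $s\in[t,T]$, is the solution of the MFG system with initial data $\rho_t=\rho$.
   Context: $\mathbb T^d$ is the $d$-dimensional torus and $\mathcal P(\mathbb T^d)$ is the set of probability densities on $\mathbb T^d$. $L(x,v)$ is a Lagrangian on $\mathbb T^d\times\mathbb R^d$, strictly convex and coercive (superlinear) in $v$, and $H(x,p)=\sup_v\,(v\cdot p-L(x,v))$ is its convex conjugate; $D_pH=\partial_pH$. $F,G:\mathbb T^d\times\mathcal P(\mathbb T^d)\to\mathbb R$ are given (no potential structure is assumed). $T$ is a fixed terminal time. The first variation $\frac{\delta\mathcal U}{\delta\rho}(\rho,x)$ of a functional $\mathcal U:\mathcal P(\mathbb T^d)\to\mathbb R$ is defined by $\frac{d}{d\varepsilon}\big|_{\varepsilon=0}\mathcal U(\rho+\varepsilon\tilde\rho)=\int_{\mathbb T^d}\frac{\delta\mathcal U}{\delta\rho}(\rho,x)\tilde\rho(x)\,dx$ for all $\tilde\rho$ with $\int\tilde\rho=0$ (it is unique up to an additive constant). $\frac{\delta u}{\delta\rho}(x,\rho,y,t)$ denotes the first variation of $\rho\mapsto u(x,\rho,t)$ evaluated at the point $y$. A classical solution is one with continuous derivatives, satisfying the equation pointwise. *)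

theory Defs
  imports "HOL-Analysis.Analysis"
begin

text \<open>
  Functions on the torus are represented by their lifts to \<open>\<real>\<^sup>d\<close>, that is, by functions on
  \<open>real ^ 'd\<close> that are invariant under integer translations; integrals over the torus are integrals
  over the unit cell.
\<close>

definition torus_fun :: "(real ^ 'd \<Rightarrow> 'b) \<Rightarrow> bool" where
  "torus_fun f \<longleftrightarrow> (\<forall>x k. (\<forall>i. k $ i \<in> \<int>) \<longrightarrow> f (x + k) = f x)"

abbreviation torus_cell :: "(real ^ 'd) set" where
  "torus_cell \<equiv> cbox 0 1"

definition densities :: "(real ^ 'd \<Rightarrow> real) set" where
  "densities = {\<rho>. torus_fun \<rho> \<and> (\<forall>x. 0 \<le> \<rho> x) \<and>
     \<rho> absolutely_integrable_on torus_cell \<and> integral torus_cell \<rho> = 1}"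

text \<open>
  The derivative in \<open>\<epsilon>\<close> is taken within the set of those \<open>\<epsilon>\<close> for which the perturbed function is
  still a density. It is two-sided for directions that are admissible on both sides, one-sided for
  directions that are admissible on one side only (for instance where \<open>\<rho>\<close> vanishes), and no condition
  arises if the direction is not admissible at all.
\<close>

definition first_variation ::
  "((real ^ 'd \<Rightarrow> real) \<Rightarrow> real) \<Rightarrow> (real ^ 'd \<Rightarrow> real) \<Rightarrow> (real ^ 'd \<Rightarrow> real) \<Rightarrow> bool" where
  "first_variation U \<rho> V \<longleftrightarrow> torus_fun V \<and>
     (\<forall>\<eta>. torus_fun \<eta> \<and> \<eta> absolutely_integrable_on torus_cell \<and> integral torus_cell \<eta> = 0 \<longrightarrow>
        (\<lambda>y. V y * \<eta> y) absolutely_integrable_on torus_cell \<and>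
        ((\<lambda>\<epsilon>. U (\<lambda>y. \<rho> y + \<epsilon> * \<eta> y)) has_real_derivative integral torus_cell (\<lambda>y. V y * \<eta> y))
          (at 0 within {\<epsilon>. (\<lambda>y. \<rho> y + \<epsilon> * \<eta> y) \<in> densities}))"

definition grad :: "(real ^ 'd \<Rightarrow> real) \<Rightarrow> real ^ 'd \<Rightarrow> real ^ 'd" where
  "grad f x = (THE D. GDERIV f x :> D)"

definition divergence :: "(real ^ 'd \<Rightarrow> real ^ 'd) \<Rightarrow> real ^ 'd \<Rightarrow> real" where
  "divergence b x = (\<Sum>i\<in>Basis. frechet_derivative b (at x) i \<bullet> i)"

text \<open>
  Joint continuity in \<open>v\<close> and \<open>x\<close> is the regularity that is implicit in the word Lagrangian.
\<close>

definition lagrangian :: "(real ^ 'd \<Rightarrow> real ^ 'd \<Rightarrow> real) \<Rightarrow> bool" where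
  "lagrangian L \<longleftrightarrow>
     continuous_on UNIV (\<lambda>(x, v). L x v) \<and>
     (\<forall>v. torus_fun (\<lambda>x. L x v)) \<and>
     (\<forall>x v w. \<forall>\<theta>::real. v \<noteq> w \<longrightarrow> 0 < \<theta> \<longrightarrow> \<theta> < 1 \<longrightarrow>
        L x ((1 - \<theta>) *\<^sub>R v + \<theta> *\<^sub>R w) < (1 - \<theta>) * L x v + \<theta> * L x w) \<and>
     (\<forall>x. filterlim (\<lambda>v. L x v / norm v) at_top at_infinity)"

definition hamiltonian :: "(real ^ 'd \<Rightarrow> real ^ 'd \<Rightarrow> real) \<Rightarrow> real ^ 'd \<Rightarrow> real ^ 'd \<Rightarrow> real" where
  "hamiltonian L x p = (SUP v. v \<bullet> p - L x v)"

definition DpH :: "(real ^ 'd \<Rightarrow> real ^ 'd \<Rightarrow> real) \<Rightarrow> real ^ 'd \<Rightarrow> real ^ 'd \<Rightarrow> real ^ 'd" where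
  "DpH L x p = grad (hamiltonian L x) p"

text \<open>
  Time derivatives are one-sided at the end points of the time interval \<open>I\<close>, and are passed as an
  explicit function.
\<close>

definition C1_time :: "real set \<Rightarrow> (real \<Rightarrow> real ^ 'd \<Rightarrow> real) \<Rightarrow> (real \<Rightarrow> real ^ 'd \<Rightarrow> real) \<Rightarrow> bool" where
  "C1_time I f f' \<longleftrightarrow>
     (\<forall>s\<in>I. torus_fun (f s)) \<and>
     continuous_on (I \<times> UNIV) (\<lambda>(s, x). f s x) \<and>
     (\<forall>s\<in>I. \<forall>x. ((\<lambda>r. f r x) has_real_derivative f' s x) (at s within I)) \<and>
     continuous_on (I \<times> UNIV) (\<lambda>(s, x). f' s x)"

definition C1_space :: "real set \<Rightarrow> (real \<Rightarrow> real ^ 'd \<Rightarrow> real) \<Rightarrow> bool" where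
  "C1_space I f \<longleftrightarrow>
     (\<forall>s\<in>I. \<forall>x. GDERIV (f s) x :> grad (f s) x) \<and>
     continuous_on (I \<times> UNIV) (\<lambda>(s, x). grad (f s) x)"

text \<open>
  The spatial derivatives that are required are those that occur in the equations: the gradient of
  \<open>\<Phi>\<close> and the derivative of the flux \<open>\<rho> DpH(x, \<nabla>\<Phi>)\<close>.
\<close>

definition mfg_solution ::
  "(real ^ 'd \<Rightarrow> real ^ 'd \<Rightarrow> real) \<Rightarrow>
   (real ^ 'd \<Rightarrow> (real ^ 'd \<Rightarrow> real) \<Rightarrow> real) \<Rightarrow> (real ^ 'd \<Rightarrow> (real ^ 'd \<Rightarrow> real) \<Rightarrow> real) \<Rightarrow>
   real \<Rightarrow> real \<Rightarrow> (real ^ 'd \<Rightarrow> real) \<Rightarrow>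
   (real \<Rightarrow> real ^ 'd \<Rightarrow> real) \<Rightarrow> (real \<Rightarrow> real ^ 'd \<Rightarrow> real) \<Rightarrow> bool" where
  "mfg_solution L F G t T \<rho>\<^sub>0 \<rho> \<Phi> \<longleftrightarrow>
     (\<exists>\<rho>' \<Phi>'. let flux = (\<lambda>s x. \<rho> s x *\<^sub>R DpH L x (grad (\<Phi> s) x)) in
        (\<forall>s\<in>{t..T}. \<rho> s \<in> densities) \<and>
        C1_time {t..T} \<rho> \<rho>' \<and>
        C1_time {t..T} \<Phi> \<Phi>' \<and> C1_space {t..T} \<Phi> \<and>
        (\<forall>s\<in>{t..T}. \<forall>x. flux s differentiable (at x)) \<and>
        (\<forall>h. continuous_on ({t..T} \<times> UNIV) (\<lambda>(s, x). frechet_derivative (flux s) (at x) h)) \<and>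
        (\<forall>s\<in>{t..T}. \<forall>x. \<rho>' s x + divergence (flux s) x = 0) \<and>
        (\<forall>s\<in>{t..T}. \<forall>x. \<Phi>' s x + hamiltonian L x (grad (\<Phi> s) x) + F x (\<rho> s) = 0) \<and>
        (\<forall>x. \<rho> t x = \<rho>\<^sub>0 x) \<and>
        (\<forall>x. \<Phi> T x = G x (\<rho> T)))"

text \<open>
  Joint continuity of a function of \<open>(x, \<rho>, y, t)\<close>, where \<open>x\<close> and \<open>y\<close> are points, \<open>\<rho>\<close> is a density and
  \<open>t \<le> T\<close>. Densities carry the \<open>L\<^sup>1\<close> topology.
\<close>

definition jointly_continuous ::
  "real \<Rightarrow> (real ^ 'd \<Rightarrow> (real ^ 'd \<Rightarrow> real) \<Rightarrow> real ^ 'd \<Rightarrow> real \<Rightarrow> 'b::topological_space) \<Rightarrow> bool" where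
  "jointly_continuous T f \<longleftrightarrow>
     (\<forall>X x R \<rho> Y y S s.
        X \<longlonglongrightarrow> x \<and> Y \<longlonglongrightarrow> y \<and> S \<longlonglongrightarrow> s \<and> (\<forall>n. S n \<le> T) \<and> s \<le> T \<and>
        (\<forall>n. R n \<in> densities) \<and> \<rho> \<in> densities \<and>
        (\<lambda>n. integral torus_cell (\<lambda>z. \<bar>R n z - \<rho> z\<bar>)) \<longlonglongrightarrow> 0 \<longrightarrow>
        (\<lambda>n::nat. f (X n) (R n) (Y n) (S n)) \<longlonglongrightarrow> f x \<rho> y s)"

definition transport_term ::
  "(real ^ 'd \<Rightarrow> real ^ 'd \<Rightarrow> real) \<Rightarrow> (real ^ 'd \<Rightarrow> real) \<Rightarrow> (real ^ 'd \<Rightarrow> real) \<Rightarrow>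
   (real ^ 'd \<Rightarrow> real) \<Rightarrow> real" where
  "transport_term L \<rho> \<psi> V =
     integral torus_cell (\<lambda>y. (DpH L y (grad \<psi> y) \<bullet> grad V y) * \<rho> y)"

text \<open>
  \<open>du x \<rho> y t\<close> is a version of the first variation of \<open>u\<close> in \<open>\<rho>\<close> at the point \<open>y\<close>. It is determined
  up to an additive term not depending on \<open>y\<close>, which does not affect its gradient in \<open>y\<close>.
\<close>

definition master_solution ::
  "(real ^ 'd \<Rightarrow> real ^ 'd \<Rightarrow> real) \<Rightarrow>
   (real ^ 'd \<Rightarrow> (real ^ 'd \<Rightarrow> real) \<Rightarrow> real) \<Rightarrow> (real ^ 'd \<Rightarrow> (real ^ 'd \<Rightarrow> real) \<Rightarrow> real) \<Rightarrow> real \<Rightarrow>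
   (real ^ 'd \<Rightarrow> (real ^ 'd \<Rightarrow> real) \<Rightarrow> real \<Rightarrow> real) \<Rightarrow>
   (real ^ 'd \<Rightarrow> (real ^ 'd \<Rightarrow> real) \<Rightarrow> real ^ 'd \<Rightarrow> real \<Rightarrow> real) \<Rightarrow> bool" where
  "master_solution L F G T u du \<longleftrightarrow>
     (\<exists>u'.
        (\<forall>\<rho>\<in>densities. \<forall>s\<le>T. torus_fun (\<lambda>x. u x \<rho> s)) \<and>
        (\<forall>\<rho>\<in>densities. \<forall>s\<le>T. \<forall>y. torus_fun (\<lambda>x. du x \<rho> y s)) \<and>
        (\<forall>x. \<forall>\<rho>\<in>densities. \<forall>s\<le>T.
           ((\<lambda>r. u x \<rho> r) has_real_derivative u' x \<rho> s) (at s within {..T}) \<and>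
           GDERIV (\<lambda>x. u x \<rho> s) x :> grad (\<lambda>x. u x \<rho> s) x \<and>
           first_variation (\<lambda>\<mu>. u x \<mu> s) \<rho> (\<lambda>y. du x \<rho> y s) \<and>
           (\<forall>y. GDERIV (\<lambda>y. du x \<rho> y s) y :> grad (\<lambda>y. du x \<rho> y s) y)) \<and>
        jointly_continuous T (\<lambda>x \<rho> y s. u x \<rho> s) \<and>
        jointly_continuous T (\<lambda>x \<rho> y s. u' x \<rho> s) \<and>
        jointly_continuous T (\<lambda>x \<rho> y s. grad (\<lambda>x. u x \<rho> s) x) \<and>
        jointly_continuous T (\<lambda>x \<rho> y s. du x \<rho> y s) \<and>
        jointly_continuous T (\<lambda>x \<rho> y s. grad (\<lambda>y. du x \<rho> y s) y) \<and>
        (\<forall>x. \<forall>\<rho>\<in>densities. \<forall>s\<le>T.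
           u' x \<rho> s + hamiltonian L x (grad (\<lambda>x. u x \<rho> s) x) + F x \<rho>
             + transport_term L \<rho> (\<lambda>y. u y \<rho> s) (\<lambda>y. du x \<rho> y s) = 0) \<and>
        (\<forall>x. \<forall>\<rho>\<in>densities. u x \<rho> T = G x \<rho>))"

definition nonlocal_hj_solution ::
  "(real ^ 'd \<Rightarrow> real ^ 'd \<Rightarrow> real) \<Rightarrow> (real ^ 'd \<Rightarrow> (real ^ 'd \<Rightarrow> real) \<Rightarrow> real) \<Rightarrow> real \<Rightarrow> real \<Rightarrow>
   (real \<Rightarrow> real ^ 'd \<Rightarrow> real) \<Rightarrow>
   (real ^ 'd \<Rightarrow> (real ^ 'd \<Rightarrow> real) \<Rightarrow> real ^ 'd \<Rightarrow> real \<Rightarrow> real) \<Rightarrow>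
   (real ^ 'd \<Rightarrow> real \<Rightarrow> real) \<Rightarrow> (real \<Rightarrow> real ^ 'd \<Rightarrow> real) \<Rightarrow> bool" where
  "nonlocal_hj_solution L G t T \<rho> du R \<Psi> \<longleftrightarrow>
     (\<exists>\<Psi>'. C1_time {t..T} \<Psi> \<Psi>' \<and> C1_space {t..T} \<Psi> \<and>
        (\<forall>s\<in>{t..T}. \<forall>x.
           \<Psi>' s x + hamiltonian L x (grad (\<Psi> s) x)
             + transport_term L (\<rho> s) (\<Psi> s) (\<lambda>y. du x (\<rho> s) y s) = R x s) \<and>
        (\<forall>x. \<Psi> T x = G x (\<rho> T)))"

text \<open>
  Absolutely continuous curves with \<open>x' = v\<close> almost everywhere, starting from \<open>x\<^sub>0\<close> (lifted from the
  torus to \<open>\<real>\<^sup>d\<close>).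
\<close>

definition admissible ::
  "real \<Rightarrow> real \<Rightarrow> real ^ 'd \<Rightarrow> ((real \<Rightarrow> real ^ 'd) \<times> (real \<Rightarrow> real ^ 'd)) set" where
  "admissible t T x\<^sub>0 = {(v, x). v absolutely_integrable_on {t..T} \<and>
     (\<forall>s\<in>{t..T}. x s = x\<^sub>0 + integral {t..s} v)}"

text \<open>
  A superlinear Lagrangian is bounded below, so along an admissible curve a running cost that is not
  integrable has integral \<open>+\<infinity>\<close>.
\<close>

definition payoff ::
  "(real ^ 'd \<Rightarrow> real ^ 'd \<Rightarrow> real) \<Rightarrow>
   (real ^ 'd \<Rightarrow> (real ^ 'd \<Rightarrow> real) \<Rightarrow> real) \<Rightarrow> (real ^ 'd \<Rightarrow> (real ^ 'd \<Rightarrow> real) \<Rightarrow> real) \<Rightarrow>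
   real \<Rightarrow> real \<Rightarrow> (real \<Rightarrow> real ^ 'd \<Rightarrow> real) \<Rightarrow>
   (real \<Rightarrow> real ^ 'd) \<Rightarrow> (real \<Rightarrow> real ^ 'd) \<Rightarrow> ereal" where
  "payoff L F G t T \<rho> v x =
     (if (\<lambda>s. L (x s) (v s) - F (x s) (\<rho> s)) absolutely_integrable_on {t..T}
      then ereal (G (x T) (\<rho> T) - integral {t..T} (\<lambda>s. L (x s) (v s) - F (x s) (\<rho> s)))
      else -\<infinity>)"

end

theory Submission
  imports Defs
begin

text \<open>
  The proof has two independent parts: the master equation is reduced to the Hamilton-Jacobi equation
  for \<open>\<Phi>\<close>, and \<open>\<Phi>\<close> is identified with a value function.

  For the first part, consider \<open>U s x = u x (\<rho> s) s\<close>. Differentiating in \<open>s\<close> produces the time derivative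
  of \<open>u\<close> plus the pairing of \<open>du\<close> with \<open>\<partial>\<^sub>s \<rho> s\<close> (\<open>derivative_along_density_flow\<close>). The density is
  transported by the velocity \<open>DpH x (\<nabla>\<Phi>)\<close>, so the continuity equation and integration by parts on the
  torus (\<open>cell_integration_by_parts\<close>) turn this pairing into the transport term formed with \<open>\<nabla>\<Phi>\<close>. The
  master equation itself contains the transport term formed with \<open>\<nabla>U\<close>. It is not known beforehand
  that \<open>\<nabla>U = \<nabla>\<Phi>\<close>, so the two terms do not cancel at once. But if the term with \<open>\<nabla>\<Phi>\<close>, minus \<open>F\<close>, is
  regarded as a prescribed forcing \<open>R\<close>, then \<open>U\<close> solves the nonlocal Hamilton-Jacobi equation with
  forcing \<open>R\<close> (\<open>master_solution_along_flow\<close>), and \<open>\<Phi>\<close> solves the same equation trivially, its transport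
  term being equal to the one in \<open>R\<close> (\<open>mfg_value_solves_nonlocal\<close>). Uniqueness gives \<open>U = \<Phi>\<close>.

  The second part is a verification argument for a classical solution of
  \<open>\<partial>\<^sub>s \<Phi> + H(x, \<nabla>\<Phi>) + f = 0\<close>. Along an admissible curve the chain rule holds in integrated form
  (\<open>chain_rule_along_curve\<close>), and the Fenchel-Young inequality shows that no payoff exceeds
  \<open>\<Phi> t x\<close> (\<open>payoff_le_value\<close>). Conversely, the velocity that maximises \<open>v \<bullet> \<nabla>\<Phi> - L x v\<close> depends
  continuously on \<open>(s, x)\<close> (\<open>continuous_velocity\<close>) and is periodic. Hence the Euler polygons that follow it
  with small steps lose arbitrarily little (\<open>nearly_optimal_curve\<close>).
\<close>

section \<open>The Legendre transform of the Lagrangian\<close>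

lemma continuous_on_compose_curried:
  assumes "continuous_on S (\<lambda>(x, y). f x y)" "continuous_on P a" "continuous_on P b"
    and "\<And>p. p \<in> P \<Longrightarrow> (a p, b p) \<in> S"
  shows "continuous_on P (\<lambda>p. f (a p) (b p))"
  using continuous_on_compose2[OF assms(1) continuous_on_Pair[OF assms(2,3)]] assms(4) by auto

text \<open>
  Superlinearity makes \<open>L x w - w \<bullet> p\<close> exceed its value at \<open>w = 0\<close> outside a large ball, and inside the
  ball a minimum exists by compactness.
\<close>

lemma velocity_exists:
  fixes L :: "real ^ 'd \<Rightarrow> real ^ 'd \<Rightarrow> real"
  assumes L: "lagrangian L"
  shows "\<exists>v. \<forall>w. w \<bullet> p - L x w \<le> v \<bullet> p - L x v"
proof -
  have cont: "continuous_on UNIV (\<lambda>(x, v). L x v)"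
    and lim: "filterlim (\<lambda>v. L x v / norm v) at_top at_infinity"
    using L by (auto simp: lagrangian_def)
  have contx: "continuous_on UNIV (\<lambda>v. L x v - v \<bullet> p)"
    by (intro continuous_intros continuous_on_compose_curried[OF cont]) auto
  \<comment> \<open>beyond the radius where \<open>L x v \<ge> C |v|\<close>, the slope \<open>C\<close> absorbs \<open>v \<bullet> p\<close> and still leaves \<open>|L x 0|\<close>\<close>
  define C where "C = norm p + \<bar>L x 0\<bar> + 1"
  obtain B0 where B0: "\<And>v. B0 \<le> norm v \<Longrightarrow> C \<le> L x v / norm v"
    using lim unfolding filterlim_at_top eventually_at_infinity by meson
  define B where "B = max B0 1"
  obtain v where v: "v \<in> cball 0 B" and min: "\<And>w. w \<in> cball 0 B \<Longrightarrow> L x v - v \<bullet> p \<le> L x w - w \<bullet> p"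
    using continuous_attains_inf[of "cball 0 B" "\<lambda>v. L x v - v \<bullet> p"] contx
    by (force simp: B_def intro: continuous_on_subset)
  have "L x v - v \<bullet> p \<le> L x w - w \<bullet> p" if "w \<notin> cball 0 B" for w
  proof -
    have w: "norm w \<ge> B0" "norm w \<ge> 1" using that by (auto simp: B_def)
    then have "C * norm w \<le> L x w" using B0[of w] by (subst (asm) pos_le_divide_eq) auto
    moreover have "w \<bullet> p \<le> norm p * norm w" by (metis mult.commute norm_cauchy_schwarz)
    moreover have "\<bar>L x 0\<bar> * 1 \<le> \<bar>L x 0\<bar> * norm w" using w by (intro mult_left_mono) auto
    ultimately have "L x 0 \<le> L x w - w \<bullet> p" using w by (simp add: C_def algebra_simps)
    moreover have "L x v - v \<bullet> p \<le> L x 0 - 0 \<bullet> p" by (rule min) (simp add: B_def)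
    ultimately show ?thesis by simp
  qed
  with min have "\<forall>w. L x v - v \<bullet> p \<le> L x w - w \<bullet> p" by blast
  then have "\<forall>w. w \<bullet> p - L x w \<le> v \<bullet> p - L x v" by (metis diff_le_eq diff_add_eq le_diff_eq minus_diff_eq neg_le_iff_le)
  then show ?thesis by blast
qed

text \<open>
  For strictly convex \<open>L\<close> this is the derivative of the Hamiltonian in \<open>p\<close>. It is defined as a maximiser
  because the optimality argument uses exactly two properties: the supremum is attained there, and it
  depends continuously on \<open>(x, p)\<close>.
\<close>

definition velocity :: "(real ^ 'd \<Rightarrow> real ^ 'd \<Rightarrow> real) \<Rightarrow> real ^ 'd \<Rightarrow> real ^ 'd \<Rightarrow> real ^ 'd" where
  "velocity L x p = (SOME v. \<forall>w. w \<bullet> p - L x w \<le> v \<bullet> p - L x v)"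

lemma velocity_max:
  assumes "lagrangian L"
  shows "w \<bullet> p - L x w \<le> velocity L x p \<bullet> p - L x (velocity L x p)"
  using someI_ex[OF velocity_exists[OF assms]] unfolding velocity_def by blast

lemma hamiltonian_eq:
  assumes "lagrangian L"
  shows "hamiltonian L x p = velocity L x p \<bullet> p - L x (velocity L x p)"
  unfolding hamiltonian_def
  by (rule cSup_eq_maximum) (use velocity_max[OF assms] in auto)

lemma fenchel_young:
  assumes "lagrangian L"
  shows "v \<bullet> p \<le> hamiltonian L x p + L x v"
  using velocity_max[OF assms, of v p x] hamiltonian_eq[OF assms, of x p] by simp

text \<open>
  By strict convexity the midpoint of two distinct maximisers would do strictly better than both.
\<close>

lemma velocity_unique:
  assumes L: "lagrangian L" and w: "velocity L x p \<bullet> p - L x (velocity L x p) \<le> w \<bullet> p - L x w"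
  shows "w = velocity L x p"
proof (rule ccontr)
  let ?v = "velocity L x p"
  assume "w \<noteq> ?v"
  then have "L x ((1 - 1/2) *\<^sub>R w + (1/2) *\<^sub>R ?v) < (1 - 1/2) * L x w + (1/2) * L x ?v"
    using L unfolding lagrangian_def by (metis (no_types, lifting) half_gt_zero_iff less_numeral_extra(1) field_sum_of_halves half_gt_zero less_add_same_cancel1)
  moreover have "((1 - 1/2) *\<^sub>R w + (1/2) *\<^sub>R ?v) \<bullet> p = (1/2) * (w \<bullet> p) + (1/2) * (?v \<bullet> p)"
    by (simp add: inner_add_left)
  ultimately show False
    using velocity_max[OF L, of "(1 - 1/2) *\<^sub>R w + (1/2) *\<^sub>R ?v" p x] w by (simp add: field_simps)
qed

text \<open>
  Superlinearity is only assumed for each \<open>x\<close> separately, so no bound on the maximisers that is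
  uniform in \<open>x\<close> is at hand; convexity supplies one. On a small sphere around the maximiser \<open>v0\<close> at
  \<open>z0\<close> the function \<open>L x v - v \<bullet> p\<close> lies strictly above its value at \<open>v0\<close>. By compactness of the sphere
  this persists for all \<open>z\<close> near \<open>z0\<close>, and a convex function that is larger on the sphere than at the
  centre has no minimiser outside it.
\<close>

lemma continuous_velocity:
  fixes L :: "real ^ 'd \<Rightarrow> real ^ 'd \<Rightarrow> real"
  assumes L: "lagrangian L"
  shows "continuous_on UNIV (\<lambda>(x, p). velocity L x p)"
  unfolding continuous_on_iff
proof (intro ballI allI impI)
  fix z0 :: "(real ^ 'd) \<times> (real ^ 'd)" and r :: real
  assume r: "0 < r"
  define v0 where "v0 = velocity L (fst z0) (snd z0)"
  have cont: "continuous_on UNIV (\<lambda>(x, v). L x v)" using L by (auto simp: lagrangian_def)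
  let ?T = "{(v, z). L (fst z) v - v \<bullet> snd z \<le> L (fst z) v0 - v0 \<bullet> snd z}"
  have eq: "?T = {q. L (fst (snd q)) (fst q) - fst q \<bullet> snd (snd q) \<le> L (fst (snd q)) v0 - v0 \<bullet> snd (snd q)}"
    by auto
  have c: "continuous_on UNIV (\<lambda>q. L (f q) (g q))" if "continuous_on UNIV f" "continuous_on UNIV g"
    for f g :: "(real ^ 'd) \<times> (real ^ 'd) \<times> (real ^ 'd) \<Rightarrow> real ^ 'd"
    using that by (intro continuous_on_compose_curried[OF cont]) auto
  have clo: "closed ?T"
    unfolding eq by (intro closed_Collect_le continuous_intros c)
  \<comment> \<open>the parameters at which some point of the sphere is no worse than the centre: a closed set that omits \<open>z0\<close>\<close>
  let ?A = "{z. \<exists>v. v \<in> sphere v0 r \<and> (v, z) \<in> ?T}"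
  have "closed ?A" by (rule closed_compact_projection[OF _ clo]) auto
  moreover have "z0 \<notin> ?A"
  proof
    assume "z0 \<in> ?A"
    then obtain v where v: "dist v0 v = r" "L (fst z0) v - v \<bullet> snd z0 \<le> L (fst z0) v0 - v0 \<bullet> snd z0"
      by auto
    then have "v = v0" unfolding v0_def by (intro velocity_unique[OF L]) auto
    with v r show False by auto
  qed
  ultimately obtain d where d: "d > 0" "ball z0 d \<subseteq> - ?A"
    using open_contains_ball[THEN iffD1, OF open_Compl[of ?A]] by blast
  have "dist v0 (velocity L (fst z) (snd z)) < r" if "z \<in> ball z0 d" for z
  proof (rule ccontr)
    let ?x = "fst z" and ?p = "snd z"
    let ?v = "velocity L ?x ?p"
    assume "\<not> dist v0 ?v < r"
    then have n: "r \<le> norm (?v - v0)" by (simp add: dist_norm norm_minus_commute)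
    \<comment> \<open>\<open>w\<close> is the point where the segment from \<open>v0\<close> to the supposedly distant maximiser crosses the sphere\<close>
    define \<theta> where "\<theta> = r / norm (?v - v0)"
    have th: "0 < \<theta>" "\<theta> \<le> 1" using n r by (auto simp: \<theta>_def divide_le_eq intro!: divide_pos_pos)
    define w where "w = (1 - \<theta>) *\<^sub>R v0 + \<theta> *\<^sub>R ?v"
    have "w - v0 = \<theta> *\<^sub>R (?v - v0)" by (simp add: w_def algebra_simps)
    then have nw: "norm (w - v0) = r" using n r by (auto simp: \<theta>_def)
    have "L ?x w \<le> (1 - \<theta>) * L ?x v0 + \<theta> * L ?x ?v"
    proof (cases "\<theta> = 1")
      case False
      with th have "\<theta> < 1" by simp
      moreover have "v0 \<noteq> ?v" using n r by auto
      ultimately show ?thesis using L th unfolding lagrangian_def w_def by (meson less_imp_le)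
    qed (simp add: w_def)
    moreover have "w \<bullet> ?p = (1 - \<theta>) * (v0 \<bullet> ?p) + \<theta> * (?v \<bullet> ?p)"
      by (simp add: w_def inner_add_left)
    moreover have "\<theta> * (L ?x ?v - ?v \<bullet> ?p) \<le> \<theta> * (L ?x v0 - v0 \<bullet> ?p)"
      using velocity_max[OF L, of v0 ?p ?x] th by (intro mult_left_mono) auto
    ultimately have "L ?x w - w \<bullet> ?p \<le> L ?x v0 - v0 \<bullet> ?p" by (simp add: algebra_simps)
    then have "z \<in> ?A" using nw by (auto simp: dist_norm norm_minus_commute intro!: exI[of _ w])
    with that d show False by auto
  qed
  then show "\<exists>d>0. \<forall>x'\<in>UNIV. dist x' z0 < d \<longrightarrow>
      dist (case x' of (x, p) \<Rightarrow> velocity L x p) (case z0 of (x, p) \<Rightarrow> velocity L x p) < r"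
    using d(1) by (auto simp: v0_def dist_commute case_prod_beta intro!: exI[of _ d])
qed

lemma continuous_hamiltonian:
  fixes L :: "real ^ 'd \<Rightarrow> real ^ 'd \<Rightarrow> real"
  assumes L: "lagrangian L"
  shows "continuous_on UNIV (\<lambda>(x, p). hamiltonian L x p)"
proof -
  have cont: "continuous_on UNIV (\<lambda>(x, v). L x v)" using L by (auto simp: lagrangian_def)
  have "continuous_on UNIV (\<lambda>z. L (fst z) (velocity L (fst z) (snd z)))"
    using continuous_velocity[OF L]
    by (intro continuous_on_compose_curried[OF cont]) (auto simp: case_prod_beta intro!: continuous_intros)
  then show ?thesis
    using continuous_velocity[OF L]
    by (auto simp: hamiltonian_eq[OF L] case_prod_beta intro!: continuous_intros)
qed

lemma legendre_transform_periodic: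
  assumes "lagrangian L"
  shows "torus_fun (\<lambda>x. hamiltonian L x p)" "torus_fun (\<lambda>x. velocity L x p)" "torus_fun (\<lambda>x. DpH L x p)"
proof -
  have *: "L (x + k) = L x" if "\<forall>i. k $ i \<in> \<int>" for x k
    using assms that by (auto simp: lagrangian_def torus_fun_def fun_eq_iff)
  have "hamiltonian L (x + k) = hamiltonian L x" if "\<forall>i. k $ i \<in> \<int>" for x k
    unfolding hamiltonian_def fun_eq_iff by (simp add: *[OF that])
  then show "torus_fun (\<lambda>x. hamiltonian L x p)" "torus_fun (\<lambda>x. velocity L x p)" "torus_fun (\<lambda>x. DpH L x p)"
    by (auto simp: torus_fun_def DpH_def velocity_def *)
qed

section \<open>The chain rule along absolutely continuous curves\<close>

text \<open>
  The increments of \<open>m\<close> telescope, so an estimate on all short intervals adds up to the same estimate on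
  the whole interval.
\<close>

lemma local_bound_imp_global_bound:
  fixes f m :: "real \<Rightarrow> real"
  assumes "0 < \<delta>" "a \<le> b"
    and loc: "\<And>c d. a \<le> c \<Longrightarrow> c \<le> d \<Longrightarrow> d \<le> b \<Longrightarrow> d - c \<le> \<delta> \<Longrightarrow> \<bar>f d - f c\<bar> \<le> m d - m c"
  shows "\<bar>f b - f a\<bar> \<le> m b - m a"
proof -
  have "a \<le> d \<Longrightarrow> d \<le> b \<Longrightarrow> d - a \<le> real n * \<delta> \<Longrightarrow> \<bar>f d - f a\<bar> \<le> m d - m a" for n d
  proof (induction n arbitrary: d)
    case 0
    then show ?case using loc[of a d] assms by auto
  next
    case (Suc n)
    define c where "c = max a (d - \<delta>)"
    have "\<bar>f c - f a\<bar> \<le> m c - m a"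
      using Suc assms by (intro Suc.IH) (auto simp: c_def algebra_simps max_def)
    moreover have "\<bar>f d - f c\<bar> \<le> m d - m c"
      using Suc assms by (intro loc) (auto simp: c_def)
    ultimately show ?case by linarith
  qed
  moreover obtain n where "b - a \<le> real n * \<delta>"
    using reals_Archimedean3[OF \<open>0 < \<delta>\<close>] less_imp_le by blast
  ultimately show ?thesis using \<open>a \<le> b\<close> by blast
qed

lemma gradient_mean_value:
  fixes f :: "'a::euclidean_space \<Rightarrow> real"
  assumes "\<And>z. GDERIV f z :> g z"
  shows "\<exists>z\<in>closed_segment a b. f b - f a = g z \<bullet> (b - a)"
proof -
  let ?h = "\<lambda>\<tau>. f (a + \<tau> *\<^sub>R (b - a))"
  have "(?h has_derivative (\<lambda>r. (r *\<^sub>R (b - a)) \<bullet> g (a + \<tau> *\<^sub>R (b - a)))) (at \<tau> within {0..1})" for \<tau> :: real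
    by (rule has_derivative_compose[of "\<lambda>\<tau>. a + \<tau> *\<^sub>R (b - a)" "\<lambda>r. r *\<^sub>R (b - a)" _ _ f])
       (use assms in \<open>auto simp: gderiv_def intro!: derivative_eq_intros\<close>)
  then obtain \<tau> where \<tau>: "0 < \<tau>" "\<tau> < 1" "?h 1 - ?h 0 = (1 *\<^sub>R (b - a)) \<bullet> g (a + \<tau> *\<^sub>R (b - a))"
    using mvt_simple[of 0 1 ?h "\<lambda>\<tau> r. (r *\<^sub>R (b - a)) \<bullet> g (a + \<tau> *\<^sub>R (b - a))"] by auto
  then show ?thesis
    by (intro bexI[of _ "a + \<tau> *\<^sub>R (b - a)"])
       (auto simp: inner_commute in_segment algebra_simps intro!: exI[of _ \<tau>])
qed

lemma integral_Icc_diff: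
  fixes f :: "real \<Rightarrow> 'a::banach"
  assumes "f integrable_on {a..b}" "a \<le> c" "c \<le> d" "d \<le> b"
  shows "integral {a..d} f - integral {a..c} f = integral {c..d} f"
proof -
  have "f integrable_on {a..d}" by (rule integrable_on_subinterval[OF assms(1)]) (use assms in auto)
  then show ?thesis using Henstock_Kurzweil_Integration.integral_combine[of a c d f] assms
    by (metis add_diff_cancel_left')
qed

text \<open>
  The curve is only absolutely continuous, and the chain rule is obtained in integrated form without
  differentiating it. On a short interval \<open>[c, h]\<close> the increment splits into a time increment at the
  fixed point \<open>x h\<close> and a space increment at the fixed time \<open>c\<close>. The mean value theorem turns them into
  \<open>f' \<zeta> (x h) (h - c)\<close> and \<open>g c \<xi> \<bullet> (x h - x c)\<close>, where \<open>x h - x c\<close> is the integral of \<open>v\<close>. Uniform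
  continuity of \<open>f'\<close> and \<open>g\<close> on a compact set containing the curve bounds the distance to the integral
  of \<open>f' s (x s) + g s (x s) \<bullet> v s\<close> over \<open>[c, h]\<close> by \<open>e\<close> times the integral of \<open>1 + |v|\<close>. These bounds
  add up, and \<open>e\<close> is arbitrary.
\<close>

lemma chain_rule_along_curve:
  fixes f f' :: "real \<Rightarrow> 'a::euclidean_space \<Rightarrow> real" and g :: "real \<Rightarrow> 'a \<Rightarrow> 'a" and x v :: "real \<Rightarrow> 'a"
  assumes ab: "a \<le> b"
    and ft: "\<And>s z. s \<in> {a..b} \<Longrightarrow> ((\<lambda>r. f r z) has_real_derivative f' s z) (at s within {a..b})"
    and fx: "\<And>s z. s \<in> {a..b} \<Longrightarrow> GDERIV (f s) z :> g s z"
    and cf': "continuous_on ({a..b} \<times> UNIV) (\<lambda>(s, z). f' s z)"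
    and cg: "continuous_on ({a..b} \<times> UNIV) (\<lambda>(s, z). g s z)"
    and v: "v absolutely_integrable_on {a..b}"
    and x: "\<And>s. s \<in> {a..b} \<Longrightarrow> x s = x\<^sub>0 + integral {a..s} v"
  shows "((\<lambda>s. f' s (x s) + g s (x s) \<bullet> v s) has_integral f b (x b) - f a (x a)) {a..b}"
proof -
  let ?w = "\<lambda>s. f' s (x s) + g s (x s) \<bullet> v s"
  have vi: "v integrable_on {a..b}" and nvi: "(\<lambda>s. norm (v s)) integrable_on {a..b}"
    using v by (auto simp: absolutely_integrable_on_def)
  have cx: "continuous_on {a..b} x"
    by (rule continuous_on_eq[OF continuous_on_add[OF continuous_on_const indefinite_integral_continuous_1[OF vi], of x\<^sub>0]])
       (simp add: x)
  have cg1: "continuous_on {a..b} (\<lambda>s. g s (x s))"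
    by (rule continuous_on_compose_curried[OF cg]) (auto intro: cx)
  have cf1: "continuous_on {a..b} (\<lambda>s. f' s (x s))"
    by (rule continuous_on_compose_curried[OF cf']) (auto intro: cx)
  have "(\<lambda>s. g s (x s) \<bullet> v s) absolutely_integrable_on {a..b}"
    by (rule absolutely_integrable_bounded_measurable_product[OF _ _ _ _ v])
       (auto intro: cg1 continuous_imp_measurable_on_sets_lebesgue compact_imp_bounded compact_continuous_image
          bounded_bilinear_inner[THEN bilinear_conv_bounded_bilinear[THEN iffD2]])
  then have wi: "?w integrable_on {a..b}"
    by (intro integrable_add[OF integrable_continuous_real[OF cf1]]) (auto simp: absolutely_integrable_on_def)
  have bound: "\<bar>(f b (x b) - f a (x a)) - integral {a..b} ?w\<bar> \<le> e * (integral {a..b} (\<lambda>s. 1 + norm (v s)))"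
    if e: "0 < e" for e
  proof -
    have "bounded (x ` {a..b})" by (intro compact_imp_bounded compact_continuous_image cx) auto
    then obtain R where "\<forall>z\<in>x ` {a..b}. norm z \<le> R" unfolding bounded_iff by blast
    then have R: "norm (x s) \<le> R" if "s \<in> {a..b}" for s using that by blast
    let ?K = "{a..b} \<times> cball 0 R"
    have "uniformly_continuous_on ?K (\<lambda>(s, z). f' s z)" "uniformly_continuous_on ?K (\<lambda>(s, z). g s z)"
      by (auto intro!: compact_uniformly_continuous compact_Times continuous_on_subset[OF cf'] continuous_on_subset[OF cg])
    note uc = this[unfolded uniformly_continuous_on_def, rule_format, OF e]
    obtain d1 where "0 < d1"
      and f'd: "\<And>p q. p \<in> ?K \<Longrightarrow> q \<in> ?K \<Longrightarrow> dist q p < d1 \<Longrightarrow> dist (case q of (s, z) \<Rightarrow> f' s z) (case p of (s, z) \<Rightarrow> f' s z) < e"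
      using uc(1) by blast
    obtain d2 where "0 < d2"
      and gd: "\<And>p q. p \<in> ?K \<Longrightarrow> q \<in> ?K \<Longrightarrow> dist q p < d2 \<Longrightarrow> dist (case q of (s, z) \<Rightarrow> g s z) (case p of (s, z) \<Rightarrow> g s z) < e"
      using uc(2) by blast
    \<comment> \<open>the points \<open>(\<zeta>, x h)\<close> and \<open>(c, \<xi>)\<close> are within \<open>d\<close> in time and \<open>2 * d\<close> in space of \<open>(r, x r)\<close>: \<open>3 * d\<close> in all\<close>
    define d where "d = min d1 d2 / 4"
    have d0: "0 < d" using \<open>0 < d1\<close> \<open>0 < d2\<close> by (auto simp: d_def)
    obtain d3 where d3: "0 < d3" and xd: "\<And>r s. r \<in> {a..b} \<Longrightarrow> s \<in> {a..b} \<Longrightarrow> dist s r < d3 \<Longrightarrow> dist (x s) (x r) < d"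
      using compact_uniformly_continuous[OF cx compact_Icc, unfolded uniformly_continuous_on_def, rule_format, OF d0]
      by blast
    define \<delta> where "\<delta> = min d (d3 / 2)"
    have near: "\<bar>f' s z - f' r (x r)\<bar> < e \<and> norm (g s z - g r (x r)) < e"
      if "s \<in> {a..b}" "r \<in> {a..b}" "\<bar>s - r\<bar> \<le> d" "norm z \<le> R" "dist z (x r) \<le> 2 * d" for s r z
    proof -
      have "dist (s, z) (r, x r) \<le> \<bar>s - r\<bar> + dist z (x r)"
        using sqrt_sum_squares_le_sum_abs[of "dist s r" "dist z (x r)"] by (simp add: dist_Pair_Pair dist_real_def)
      also have "\<dots> < min d1 d2" using that d0 unfolding d_def by linarith
      finally show ?thesis
        using f'd[of "(r, x r)" "(s, z)"] gd[of "(r, x r)" "(s, z)"] that R[of r] by (auto simp: dist_norm)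
    qed
    let ?f = "\<lambda>s. f s (x s) - integral {a..s} ?w"
    let ?m = "\<lambda>s. e * integral {a..s} (\<lambda>s. 1 + norm (v s))"
    \<comment> \<open>the bound is applied to the defect \<open>?f\<close>, with the additive interval function \<open>?m\<close> as majorant\<close>
    have onei: "(\<lambda>s. 1 + norm (v s)) integrable_on {a..b}" by (intro integrable_add nvi) auto
    have "\<bar>?f b - ?f a\<bar> \<le> ?m b - ?m a"
    proof (rule local_bound_imp_global_bound[OF _ ab, of \<delta>])
      show "0 < \<delta>" using d0 d3 by (simp add: \<delta>_def)
      fix c h assume c: "a \<le> c" "c \<le> h" "h \<le> b" "h - c \<le> \<delta>"
      show "\<bar>?f h - ?f c\<bar> \<le> ?m h - ?m c"
      proof (cases "c = h")
        case False
        with c have ch: "c < h" by simp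
        have sub: "{c..h} \<subseteq> {a..b}" using c by auto
        have "((\<lambda>r. f r (x h)) has_derivative (\<lambda>k. k * f' s (x h))) (at s within {c..h})" if "c \<le> s" "s \<le> h" for s
          using DERIV_subset[OF ft[of s "x h"] sub] that sub
          by (auto simp: has_field_derivative_def mult.commute[of _ "f' _ _"])
        then obtain \<zeta> where \<zeta>: "c < \<zeta>" "\<zeta> < h" "f h (x h) - f c (x h) = (h - c) * f' \<zeta> (x h)"
          using mvt_simple[OF ch, of "\<lambda>r. f r (x h)" "\<lambda>s k. k * f' s (x h)"] by auto
        obtain \<xi> where \<xi>: "\<xi> \<in> closed_segment (x c) (x h)" "f c (x h) - f c (x c) = g c \<xi> \<bullet> (x h - x c)"
          using gradient_mean_value[of "f c" "g c" "x c" "x h"] fx[of c] c by auto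
        have R\<xi>: "norm \<xi> \<le> R"
          using \<xi>(1) closed_segment_subset[of "x c" "cball 0 R" "x h"] R[of c] R[of h] c by auto
        have vch: "v integrable_on {c..h}" and wch: "?w integrable_on {c..h}"
          and nch: "(\<lambda>s. 1 + norm (v s)) integrable_on {c..h}"
          using sub by (auto intro: integrable_on_subinterval vi wi onei)
        have xhc: "x h - x c = integral {c..h} v"
          using x[of h] x[of c] c integral_Icc_diff[OF vi, of c h] by simp
        have gv: "(\<lambda>r. g c \<xi> \<bullet> v r) integrable_on {c..h}" "g c \<xi> \<bullet> integral {c..h} v = integral {c..h} (\<lambda>r. g c \<xi> \<bullet> v r)"
          using integrable_linear[OF vch bounded_linear_inner_right, of "g c \<xi>"]
            integral_linear[OF vch bounded_linear_inner_right, of "g c \<xi>"] by (auto simp: o_def)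
        have "?f h - ?f c = (f h (x h) - f c (x h)) + (f c (x h) - f c (x c)) - integral {c..h} ?w"
          using integral_Icc_diff[OF wi, of c h] c by simp
        also have "\<dots> = integral {c..h} (\<lambda>r. f' \<zeta> (x h) + g c \<xi> \<bullet> v r) - integral {c..h} ?w"
          using gv ch by (simp add: \<zeta> \<xi> xhc Henstock_Kurzweil_Integration.integral_add[OF integrable_const_ivl gv(1)])
        also have "\<dots> = integral {c..h} (\<lambda>r. (f' \<zeta> (x h) + g c \<xi> \<bullet> v r) - ?w r)"
          by (rule integral_diff[symmetric]) (auto intro!: integrable_add gv wch)
        also have "\<bar>\<dots>\<bar> \<le> integral {c..h} (\<lambda>r. e * (1 + norm (v r)))"
          unfolding real_norm_def[symmetric]
        proof (rule Henstock_Kurzweil_Integration.integral_norm_bound_integral)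
          show "(\<lambda>r. (f' \<zeta> (x h) + g c \<xi> \<bullet> v r) - ?w r) integrable_on {c..h}"
            by (intro integrable_diff integrable_add gv wch) auto
          show "(\<lambda>r. e * (1 + norm (v r))) integrable_on {c..h}" using nch by (rule integrable_on_mult_right)
          fix r assume r: "r \<in> {c..h}"
          have rab: "r \<in> {a..b}" using r sub by auto
          have dxs: "dist (x s) (x r) < d" if "s \<in> {c..h}" for s
            using that r c xd[of r s] d3 sub by (auto simp: \<delta>_def dist_real_def)
          have 1: "\<bar>f' \<zeta> (x h) - f' r (x r)\<bar> < e"
            using near[of \<zeta> r "x h"] \<zeta> r rab c dxs[of h] d0 R[of h] by (auto simp: \<delta>_def)
          have "dist \<xi> (x r) \<le> 2 * d"
          proof -
            have "closed_segment (x c) (x h) \<subseteq> cball (x r) (2 * d)"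
              using dxs[of c] dxs[of h] ch d0 by (intro closed_segment_subset) (auto simp: dist_commute)
            with \<xi> show ?thesis by (auto simp: dist_commute)
          qed
          then have 2: "norm (g c \<xi> - g r (x r)) < e"
            using near[of c r \<xi>] r rab c R\<xi> by (auto simp: \<delta>_def)
          have "norm ((f' \<zeta> (x h) + g c \<xi> \<bullet> v r) - ?w r) = \<bar>(f' \<zeta> (x h) - f' r (x r)) + (g c \<xi> - g r (x r)) \<bullet> v r\<bar>"
            by (simp add: inner_diff_left)
          also have "\<dots> \<le> e + norm (g c \<xi> - g r (x r)) * norm (v r)"
            using 1 Cauchy_Schwarz_ineq2[of "g c \<xi> - g r (x r)" "v r"] by linarith
          also have "\<dots> \<le> e + e * norm (v r)" using 2 by (intro add_left_mono mult_right_mono) auto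
          finally show "norm ((f' \<zeta> (x h) + g c \<xi> \<bullet> v r) - ?w r) \<le> e * (1 + norm (v r))" by (simp add: algebra_simps)
        qed
        also have "\<dots> = ?m h - ?m c"
          using integral_Icc_diff[OF onei, of c h] c by (simp add: right_diff_distrib[symmetric])
        finally show ?thesis .
      qed simp
    qed
    then show ?thesis by simp
  qed
  have "\<bar>(f b (x b) - f a (x a)) - integral {a..b} ?w\<bar> \<le> 0"
  proof -
    define I where "I = integral {a..b} (\<lambda>s. 1 + norm (v s))"
    have I0: "0 \<le> I" unfolding I_def
      by (intro Henstock_Kurzweil_Integration.integral_nonneg integrable_add nvi) auto
    show ?thesis
    proof (rule field_le_epsilon)
      fix e :: real assume e: "0 < e"
      have "\<bar>(f b (x b) - f a (x a)) - integral {a..b} ?w\<bar> \<le> (e / (I + 1)) * I"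
        using bound[of "e / (I + 1)"] e I0 unfolding I_def[symmetric] by auto
      also have "\<dots> \<le> 0 + e" using e I0 by (simp add: field_simps)
      finally show "\<bar>(f b (x b) - f a (x a)) - integral {a..b} ?w\<bar> \<le> 0 + e" .
    qed
  qed
  then show ?thesis using integrable_integral[OF wi] by simp
qed

section \<open>Integration by parts on the torus\<close>

text \<open>
  The translated cell sticks out by a slab \<open>1 \<le> x \<bullet> i \<le> 1 + h\<close>; moving this slab back by the period \<open>i\<close>
  fills exactly the part \<open>0 \<le> x \<bullet> i \<le> h\<close> of the cell that the translation has uncovered.
\<close>

lemma cell_integral_translate:
  fixes f :: "real ^ 'd \<Rightarrow> real"
  assumes per: "torus_fun f" and cont: "continuous_on UNIV f" and i: "i \<in> Basis" and h: "0 \<le> h" "h \<le> 1"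
  shows "integral torus_cell (\<lambda>x. f (x + h *\<^sub>R i)) = integral torus_cell f"
proof -
  have int: "f integrable_on cbox a b" for a b
    by (rule integrable_continuous) (rule continuous_on_subset[OF cont], simp)
  have one: "(1::real^'d) \<bullet> j = 1" if "j \<in> Basis" for j
    using that by (auto simp: Basis_vec_def inner_axis)
  have i2: "i \<bullet> j = (if i = j then 1 else 0)" if "j \<in> Basis" for j
    using i that by (simp add: inner_Basis)
  \<comment> \<open>membership in a box that differs from the cell only in direction \<open>i\<close>\<close>
  have box: "x \<in> cbox (a *\<^sub>R i) (1 + c *\<^sub>R i) \<longleftrightarrow>
      (a \<le> x \<bullet> i \<and> x \<bullet> i \<le> 1 + c) \<and> (\<forall>j\<in>Basis - {i}. 0 \<le> x \<bullet> j \<and> x \<bullet> j \<le> 1)" for a c x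
  proof -
    have "x \<in> cbox (a *\<^sub>R i) (1 + c *\<^sub>R i) \<longleftrightarrow>
        (\<forall>j\<in>insert i (Basis - {i}). a * (i \<bullet> j) \<le> x \<bullet> j \<and> x \<bullet> j \<le> 1 + c * (i \<bullet> j))"
      using i by (auto simp: mem_box inner_add_left one insert_absorb)
    also have "\<dots> \<longleftrightarrow> (a \<le> x \<bullet> i \<and> x \<bullet> i \<le> 1 + c) \<and> (\<forall>j\<in>Basis - {i}. 0 \<le> x \<bullet> j \<and> x \<bullet> j \<le> 1)"
      unfolding ball_insert using i by (auto simp: i2)
    finally show ?thesis .
  qed
  have "1 + (h - 1) *\<^sub>R i = 1 + h *\<^sub>R i - i" by (simp add: algebra_simps)
  with box[of _ 0 "h - 1"] have boxh: "x \<in> cbox 0 (1 + h *\<^sub>R i - i) \<longleftrightarrow>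
      (0 \<le> x \<bullet> i \<and> x \<bullet> i \<le> h) \<and> (\<forall>j\<in>Basis - {i}. 0 \<le> x \<bullet> j \<and> x \<bullet> j \<le> 1)" for x
    by simp
  have box1: "x \<in> cbox i (1 + h *\<^sub>R i) \<longleftrightarrow>
      (1 \<le> x \<bullet> i \<and> x \<bullet> i \<le> 1 + h) \<and> (\<forall>j\<in>Basis - {i}. 0 \<le> x \<bullet> j \<and> x \<bullet> j \<le> 1)" for x
    using box[of x 1 h] by simp
  have box00: "x \<in> torus_cell \<longleftrightarrow>
      (0 \<le> x \<bullet> i \<and> x \<bullet> i \<le> 1) \<and> (\<forall>j\<in>Basis - {i}. 0 \<le> x \<bullet> j \<and> x \<bullet> j \<le> 1)" for x
    using box[of x 0 0] by simp
  have shift: "f (x + i) = f x" for x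
    using per i unfolding torus_fun_def by (auto simp: Basis_vec_def axis_def)
  have "integral torus_cell (\<lambda>x. f (x + h *\<^sub>R i)) = integral (cbox (h *\<^sub>R i) (1 + h *\<^sub>R i)) f"
    using integral_shift_cbox[of "h *\<^sub>R i" "h *\<^sub>R i" "1 + h *\<^sub>R i" f] by simp
  also have "\<dots> = integral (cbox (h *\<^sub>R i) (1 + h *\<^sub>R i) \<inter> {x. x \<bullet> i \<le> 1}) f
      + integral (cbox (h *\<^sub>R i) (1 + h *\<^sub>R i) \<inter> {x. x \<bullet> i \<ge> 1}) f"
    by (rule integral_split[OF int i])
  also have "cbox (h *\<^sub>R i) (1 + h *\<^sub>R i) \<inter> {x. x \<bullet> i \<le> 1} = torus_cell \<inter> {x. x \<bullet> i \<ge> h}"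
    by (rule set_eqI) (use h box[of _ h h] box00 in \<open>simp, linarith\<close>)
  also have "cbox (h *\<^sub>R i) (1 + h *\<^sub>R i) \<inter> {x. x \<bullet> i \<ge> 1} = cbox i (1 + h *\<^sub>R i)"
    by (rule set_eqI) (use h box[of _ h h] box1 in \<open>simp, linarith\<close>)
  also have "integral (cbox i (1 + h *\<^sub>R i)) f = integral (cbox 0 (1 + h *\<^sub>R i - i)) f"
    using integral_shift_cbox[of i i "1 + h *\<^sub>R i" f] by (simp add: shift)
  also have "cbox 0 (1 + h *\<^sub>R i - i) = torus_cell \<inter> {x. x \<bullet> i \<le> h}"
    by (rule set_eqI) (use h boxh box00 in \<open>simp, linarith\<close>)
  finally show ?thesis using integral_split[OF int[of 0 1] i, of h] by simp
qed

text \<open>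
  This is the divergence theorem on the torus. The integral of \<open>f'\<close> over the cell equals the integral
  over each of its translates by \<open>h *\<^sub>R i\<close>, hence also their average over \<open>0 \<le> h \<le> 1\<close>. After exchanging
  the order of integration the inner integral is \<open>f (x + i) - f x = 0\<close>.
\<close>

lemma cell_integral_partial_derivative:
  fixes f f' :: "real ^ 'd \<Rightarrow> real"
  assumes per: "torus_fun f" and i: "i \<in> Basis"
    and f': "\<And>x. ((\<lambda>h. f (x + h *\<^sub>R i)) has_real_derivative f' x) (at 0)"
    and cont: "continuous_on UNIV f'"
  shows "integral torus_cell f' = 0"
proof -
  have shift: "f (x + i) = f x" for x
    using per i unfolding torus_fun_def by (auto simp: Basis_vec_def axis_def)
  have per': "torus_fun f'"
    unfolding torus_fun_def
  proof (intro allI impI)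
    fix x k :: "real ^ 'd" assume k: "\<forall>j. k $ j \<in> \<int>"
    have "(\<lambda>h. f (x + k + h *\<^sub>R i)) = (\<lambda>h. f (x + h *\<^sub>R i))"
    proof
      fix h
      show "f (x + k + h *\<^sub>R i) = f (x + h *\<^sub>R i)"
        using per k unfolding torus_fun_def by (metis add.assoc add.commute)
    qed
    with f'[of "x + k"] f'[of x] show "f' (x + k) = f' x" by (metis DERIV_unique)
  qed
  have der: "((\<lambda>h. f (x + h *\<^sub>R i)) has_real_derivative f' (x + h *\<^sub>R i)) (at h)" for x h
    using DERIV_shift[of "\<lambda>h. f (x + h *\<^sub>R i)" "f' (x + h *\<^sub>R i)" 0 h] f'[of "x + h *\<^sub>R i"]
    by (simp add: algebra_simps)
  have "integral torus_cell f' = integral {0..1::real} (\<lambda>h. integral torus_cell f')" by simp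
  also have "\<dots> = integral {0..1} (\<lambda>h. integral torus_cell (\<lambda>x. f' (x + h *\<^sub>R i)))"
    by (intro Henstock_Kurzweil_Integration.integral_cong cell_integral_translate[symmetric] per' cont i) auto
  also have "\<dots> = integral torus_cell (\<lambda>x. integral {0..1} (\<lambda>h. f' (x + h *\<^sub>R i)))"
    unfolding box_real(2)[symmetric]
    by (rule integral_swap_continuous)
       (auto simp: case_prod_beta intro!: continuous_intros continuous_on_compose2[OF cont])
  also have "\<dots> = integral torus_cell (\<lambda>x::real ^ 'd. 0)"
  proof (rule Henstock_Kurzweil_Integration.integral_cong)
    fix x :: "real ^ 'd"
    have "((\<lambda>h. f' (x + h *\<^sub>R i)) has_integral f (x + 1 *\<^sub>R i) - f (x + 0 *\<^sub>R i)) {0..1}"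
      using der[of x] by (intro fundamental_theorem_of_calculus)
        (auto simp: has_real_derivative_iff_has_vector_derivative[symmetric] intro: has_field_derivative_at_within)
    then show "integral {0..1} (\<lambda>h. f' (x + h *\<^sub>R i)) = 0" by (simp add: shift integral_unique)
  qed
  finally show ?thesis by simp
qed

lemma gderiv_unique:
  fixes D E :: "'a::real_inner"
  assumes "GDERIV f x :> D" "GDERIV f x :> E"
  shows "D = E"
  using assms has_derivative_unique[of f "\<lambda>h. h \<bullet> D" x "\<lambda>h. h \<bullet> E"] unfolding gderiv_def fun_eq_iff
  by (metis inner_commute vector_eq_rdot)

lemma grad_periodic:
  fixes f :: "real ^ 'd \<Rightarrow> real"
  assumes per: "torus_fun f" and D: "\<And>x. GDERIV f x :> grad f x"
  shows "torus_fun (grad f)"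
  unfolding torus_fun_def
proof (intro allI impI)
  fix x k :: "real ^ 'd" assume k: "\<forall>i. k $ i \<in> \<int>"
  have eq: "(\<lambda>z. f (z + k)) = f" using per k by (auto simp: torus_fun_def)
  have "((\<lambda>z. f (z + k)) has_derivative (\<lambda>h. h \<bullet> grad f (x + k))) (at x)"
    using D[of "x + k"] unfolding gderiv_def
    by (intro has_derivative_compose[of "\<lambda>z. z + k" "\<lambda>h. h" _ _ f]) (auto intro!: derivative_eq_intros)
  then have "GDERIV f x :> grad f (x + k)" unfolding eq gderiv_def .
  then show "grad f (x + k) = grad f x" using D[of x] by (rule gderiv_unique)
qed

lemma cell_integration_by_parts:
  fixes \<phi> :: "real ^ 'd \<Rightarrow> real" and b :: "real ^ 'd \<Rightarrow> real ^ 'd"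
  assumes p\<phi>: "torus_fun \<phi>" and pb: "torus_fun b"
    and \<phi>: "\<And>x. GDERIV \<phi> x :> grad \<phi> x" and c\<phi>: "continuous_on UNIV (grad \<phi>)"
    and b: "\<And>x. b differentiable (at x)"
    and cb: "\<And>h. continuous_on UNIV (\<lambda>x. frechet_derivative b (at x) h)"
  shows "integral torus_cell (\<lambda>x. \<phi> x * divergence b x) = - integral torus_cell (\<lambda>x. grad \<phi> x \<bullet> b x)"
proof -
  have contb: "continuous_on UNIV b" and cont\<phi>: "continuous_on UNIV \<phi>"
    using b \<phi> unfolding gderiv_def by (auto simp: continuous_on_eq_continuous_at
        intro: differentiable_imp_continuous_within has_derivative_continuous)
  let ?D = "\<lambda>i x. (grad \<phi> x \<bullet> i) * (b x \<bullet> i) + \<phi> x * (frechet_derivative b (at x) i \<bullet> i)"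
  have contD: "continuous_on UNIV (?D i)" for i
    by (intro continuous_intros contb cont\<phi> c\<phi> cb)
  have 0: "integral torus_cell (?D i) = 0" if i: "i \<in> Basis" for i
  proof (rule cell_integral_partial_derivative[OF _ i _ contD, of "\<lambda>x. \<phi> x * (b x \<bullet> i)"])
    show "torus_fun (\<lambda>x. \<phi> x * (b x \<bullet> i))" using p\<phi> pb by (auto simp: torus_fun_def)
    fix x
    have l: "((\<lambda>h. x + h *\<^sub>R i) has_derivative (\<lambda>r. r *\<^sub>R i)) (at (0::real))"
      by (auto intro!: derivative_eq_intros)
    have "((\<lambda>h. \<phi> (x + h *\<^sub>R i)) has_derivative (\<lambda>r. (r *\<^sub>R i) \<bullet> grad \<phi> x)) (at 0)"
      using \<phi>[of x] unfolding gderiv_def by (intro has_derivative_compose[OF l]) simp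
    moreover have "((\<lambda>h. b (x + h *\<^sub>R i)) has_derivative (\<lambda>r. frechet_derivative b (at x) (r *\<^sub>R i))) (at 0)"
      using b[of x] unfolding frechet_derivative_works by (intro has_derivative_compose[OF l]) simp
    ultimately have D: "((\<lambda>h. \<phi> (x + h *\<^sub>R i) * (b (x + h *\<^sub>R i) \<bullet> i)) has_derivative
       (\<lambda>r. \<phi> x * (frechet_derivative b (at x) (r *\<^sub>R i) \<bullet> i) + ((r *\<^sub>R i) \<bullet> grad \<phi> x) * (b x \<bullet> i))) (at 0)"
      by (auto intro!: derivative_eq_intros)
    have "linear (frechet_derivative b (at x))"
      using b[of x] by (metis frechet_derivative_works has_derivative_linear)
    then show "((\<lambda>h. \<phi> (x + h *\<^sub>R i) * (b (x + h *\<^sub>R i) \<bullet> i)) has_real_derivative ?D i x) (at 0)"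
      unfolding has_field_derivative_def
      by (intro has_derivative_eq_rhs[OF D]) (simp add: linear_cmul fun_eq_iff inner_commute algebra_simps)
  qed
  have int: "(\<lambda>x. \<phi> x * divergence b x) integrable_on torus_cell" "(\<lambda>x. grad \<phi> x \<bullet> b x) integrable_on torus_cell"
    unfolding divergence_def
    by (rule integrable_continuous, rule continuous_on_subset[OF _ subset_UNIV],
        intro continuous_intros contb cont\<phi> c\<phi> cb)+
  have "grad \<phi> x \<bullet> b x + \<phi> x * divergence b x = (\<Sum>i\<in>Basis. ?D i x)" for x
    unfolding divergence_def sum.distrib sum_distrib_left by (subst euclidean_inner) simp
  then have "integral torus_cell (\<lambda>x. grad \<phi> x \<bullet> b x + \<phi> x * divergence b x) = (\<Sum>i\<in>Basis. integral torus_cell (?D i))"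
    using integral_sum[OF finite_Basis, of ?D torus_cell]
      integrable_continuous[OF continuous_on_subset[OF contD subset_UNIV]] by simp
  also have "\<dots> = 0" using 0 by simp
  finally show ?thesis using int by (simp add: Henstock_Kurzweil_Integration.integral_add)
qed

section \<open>Differentiation along a flow of densities\<close>

lemma densities_convex:
  assumes m: "\<mu> \<in> densities" and n: "\<nu> \<in> densities" and th: "0 \<le> \<theta>" "\<theta> \<le> (1::real)"
  shows "(\<lambda>y. \<mu> y + \<theta> * (\<nu> y - \<mu> y)) \<in> densities"
proof -
  have eq: "\<mu> y + \<theta> * (\<nu> y - \<mu> y) = (1 - \<theta>) * \<mu> y + \<theta> * \<nu> y" for y by (simp add: algebra_simps)
  have i: "\<mu> integrable_on torus_cell" "\<nu> integrable_on torus_cell"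
    using m n by (auto simp: densities_def absolutely_integrable_on_def)
  have "integral torus_cell (\<lambda>y. (1 - \<theta>) * \<mu> y + \<theta> * \<nu> y) = 1"
    using m n by (subst Henstock_Kurzweil_Integration.integral_add)
      (auto intro: integrable_on_mult_right i simp: densities_def)
  then show ?thesis
    using m n th unfolding eq by (auto simp: densities_def torus_fun_def)
qed

text \<open>
  The first variation is a derivative relative to the set of admissible perturbation sizes. Since
  \<open>densities\<close> is convex, at each point of the segment from \<open>\<mu>\<close> to \<open>\<nu>\<close> this set contains the whole
  remaining segment in both directions, and the one-dimensional mean value theorem applies.
\<close>

lemma first_variation_mean_value:
  assumes m: "\<mu> \<in> densities" and n: "\<nu> \<in> densities"
    and V: "\<And>\<sigma>. \<sigma> \<in> densities \<Longrightarrow> first_variation U \<sigma> (V \<sigma>)"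
  shows "\<exists>\<theta>\<in>{0..1}. U \<nu> - U \<mu> = integral torus_cell (\<lambda>y. V (\<lambda>y. \<mu> y + \<theta> * (\<nu> y - \<mu> y)) y * (\<nu> y - \<mu> y))"
proof -
  let ?\<sigma> = "\<lambda>\<theta> y. \<mu> y + \<theta> * (\<nu> y - \<mu> y)"
  let ?D = "\<lambda>\<theta>. integral torus_cell (\<lambda>y. V (?\<sigma> \<theta>) y * (\<nu> y - \<mu> y))"
  have "((\<lambda>\<theta>. U (?\<sigma> \<theta>)) has_real_derivative ?D \<theta>\<^sub>0) (at \<theta>\<^sub>0 within {0..1})" if th: "\<theta>\<^sub>0 \<in> {0..1}" for \<theta>\<^sub>0
  proof -
    let ?S = "{\<epsilon>. (\<lambda>y. ?\<sigma> \<theta>\<^sub>0 y + \<epsilon> * (\<nu> y - \<mu> y)) \<in> densities}"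
    have "torus_fun (\<lambda>y. \<nu> y - \<mu> y)" "(\<lambda>y. \<nu> y - \<mu> y) absolutely_integrable_on torus_cell"
      "integral torus_cell (\<lambda>y. \<nu> y - \<mu> y) = 0"
      using m n by (auto simp: densities_def torus_fun_def absolutely_integrable_on_def[where f=\<mu>]
          absolutely_integrable_on_def[where f=\<nu>] Henstock_Kurzweil_Integration.integral_diff)
    then have 1: "((\<lambda>\<epsilon>. U (\<lambda>y. ?\<sigma> \<theta>\<^sub>0 y + \<epsilon> * (\<nu> y - \<mu> y))) has_real_derivative ?D \<theta>\<^sub>0) (at 0 within ?S)"
      using V[OF densities_convex[OF m n, of \<theta>\<^sub>0]] th unfolding first_variation_def by auto
    have eq: "(\<lambda>y. ?\<sigma> \<theta>\<^sub>0 y + (\<theta> - \<theta>\<^sub>0) * (\<nu> y - \<mu> y)) = ?\<sigma> \<theta>" for \<theta>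
      by (auto simp: algebra_simps)
    have "(\<lambda>\<theta>. \<theta> - \<theta>\<^sub>0) ` {0..1} \<subseteq> ?S"
      by (intro image_subsetI CollectI) (simp only: eq, rule densities_convex[OF m n], auto)
    with 1 have "((\<lambda>\<epsilon>. U (\<lambda>y. ?\<sigma> \<theta>\<^sub>0 y + \<epsilon> * (\<nu> y - \<mu> y))) has_real_derivative ?D \<theta>\<^sub>0)
        (at (\<theta>\<^sub>0 - \<theta>\<^sub>0) within (\<lambda>\<theta>. \<theta> - \<theta>\<^sub>0) ` {0..1})"
      by (simp add: DERIV_subset)
    then have "((\<lambda>\<epsilon>. U (\<lambda>y. ?\<sigma> \<theta>\<^sub>0 y + \<epsilon> * (\<nu> y - \<mu> y))) \<circ> (\<lambda>\<theta>. \<theta> - \<theta>\<^sub>0) has_real_derivative ?D \<theta>\<^sub>0 * 1) (at \<theta>\<^sub>0 within {0..1})"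
      by (rule DERIV_image_chain) (auto intro!: derivative_eq_intros)
    then show ?thesis by (simp add: o_def eq)
  qed
  then have "\<exists>\<theta>\<in>{0<..<1}. U (?\<sigma> 1) - U (?\<sigma> 0) = ?D \<theta> * (1 - 0)"
    unfolding has_field_derivative_def by (intro mvt_simple[OF zero_less_one]) auto
  then show ?thesis by (auto intro: less_imp_le)
qed

text \<open>
  This replaces the sequential notion of continuity, with densities in \<open>L\<^sup>1\<close>, by ordinary continuity in a
  parameter. If \<open>R p z\<close> is continuous in \<open>(p, z)\<close>, then \<open>R\<close> is \<open>L\<^sup>1\<close>-continuous in \<open>p\<close> because the cell is
  compact.
\<close>

lemma jointly_continuous_compose:
  fixes f :: "real ^ 'd \<Rightarrow> (real ^ 'd \<Rightarrow> real) \<Rightarrow> real ^ 'd \<Rightarrow> real \<Rightarrow> 'b::topological_space"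
    and P :: "'p::{first_countable_topology, t2_space} set"
  assumes jc: "jointly_continuous T f"
    and X: "continuous_on P X" and Y: "continuous_on P Y" and S: "continuous_on P S"
    and ST: "\<And>p. p \<in> P \<Longrightarrow> S p \<le> T" and RD: "\<And>p. p \<in> P \<Longrightarrow> R p \<in> densities"
    and R: "continuous_on (P \<times> UNIV) (\<lambda>(p, z). R p z)"
  shows "continuous_on P (\<lambda>p. f (X p) (R p) (Y p) (S p))"
  unfolding continuous_on_sequentially
proof (intro allI ballI impI, elim conjE)
  fix q p assume p: "p \<in> P" and q: "\<forall>n. q n \<in> P" and lim: "q \<longlonglongrightarrow> p"
  have seq: "(\<lambda>n. h (q n)) \<longlonglongrightarrow> h p" if "continuous_on P h" for h :: "'p \<Rightarrow> 'c::topological_space"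
    using that p q lim unfolding continuous_on_sequentially o_def by blast
  have R': "continuous_on (P \<times> torus_cell) (\<lambda>z. R (fst z) (snd z))"
    using continuous_on_subset[OF R, of "P \<times> torus_cell"] by (simp add: case_prod_beta subset_iff)
  have Rp: "continuous_on UNIV (R p)"
    using continuous_on_compose_curried[OF R, of UNIV "\<lambda>_. p" "\<lambda>z. z"] p by simp
  have "continuous_on P (\<lambda>p'. integral torus_cell (\<lambda>z. \<bar>R p' z - R p z\<bar>))"
    by (rule integral_continuous_on_param)
       (auto simp: case_prod_beta intro!: continuous_intros R' continuous_on_compose2[OF Rp])
  from seq[OF this] have "(\<lambda>n. integral torus_cell (\<lambda>z. \<bar>R (q n) z - R p z\<bar>)) \<longlonglongrightarrow> 0" by simp
  then have "(\<lambda>n. f (X (q n)) (R (q n)) (Y (q n)) (S (q n))) \<longlonglongrightarrow> f (X p) (R p) (Y p) (S p)"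
    by (intro jc[unfolded jointly_continuous_def, rule_format] conjI allI seq X Y S ST RD p q[rule_format])
  then show "((\<lambda>p. f (X p) (R p) (Y p) (S p)) \<circ> q) \<longlonglongrightarrow> f (X p) (R p) (Y p) (S p)" by (simp add: o_def)
qed

text \<open>
  In this form the difference quotient is visibly continuous in \<open>(r, z)\<close> up to and including \<open>r = s\<close>.
\<close>

lemma increment_eq_mean_derivative:
  fixes f f' :: "real \<Rightarrow> 'a::euclidean_space \<Rightarrow> real"
  assumes ft: "\<And>s z. s \<in> {a..b} \<Longrightarrow> ((\<lambda>r. f r z) has_real_derivative f' s z) (at s within {a..b})"
    and s: "s \<in> {a..b}" and r: "r \<in> {a..b}"
    and cf': "continuous_on ({a..b} \<times> UNIV) (\<lambda>(s, z). f' s z)"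
  shows "f r z - f s z = (r - s) * integral {0..1} (\<lambda>\<tau>. f' (s + \<tau> * (r - s)) z)"
proof -
  have in': "s + \<tau> * (r - s) \<in> {a..b}" if "\<tau> \<in> {0..1}" for \<tau>
    using that s r convexD_alt[of "{a..b}" s r \<tau>] by (simp add: algebra_simps)
  have "((\<lambda>\<tau>. (r - s) * f' (s + \<tau> * (r - s)) z) has_integral f (s + 1 * (r - s)) z - f (s + 0 * (r - s)) z) {0..1}"
  proof (rule fundamental_theorem_of_calculus)
    fix \<tau> :: real assume \<tau>: "\<tau> \<in> {0..1}"
    have "((\<lambda>r. f r z) \<circ> (\<lambda>\<tau>. s + \<tau> * (r - s)) has_real_derivative f' (s + \<tau> * (r - s)) z * (r - s)) (at \<tau> within {0..1})"
      by (rule DERIV_image_chain, rule DERIV_subset[OF ft[OF in'[OF \<tau>]]])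
         (use in' in \<open>auto intro!: derivative_eq_intros\<close>)
    then show "((\<lambda>\<tau>. f (s + \<tau> * (r - s)) z) has_vector_derivative (r - s) * f' (s + \<tau> * (r - s)) z) (at \<tau> within {0..1})"
      by (simp add: has_real_derivative_iff_has_vector_derivative[symmetric] o_def mult.commute)
  qed simp
  from integral_unique[OF this] show ?thesis by simp
qed

text \<open>
  The increment from \<open>s\<close> to \<open>r\<close> is split at \<open>u x (\<rho> s) r\<close>. The change of time alone contributes \<open>u'x\<close>. By
  the mean value theorem for the first variation, the change of density alone is \<open>r - s\<close> times the
  integral of \<open>du\<close>, taken at an intermediate density, against the difference quotient of \<open>\<rho>\<close>. That
  integral, called \<open>J\<close>, is continuous in \<open>r\<close> and in the position \<open>\<theta>\<close> on the segment of densities. At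
  \<open>r = s\<close> the segment degenerates to the single density \<open>\<rho> s\<close>, so \<open>J\<close> does not depend on \<open>\<theta>\<close> there, and
  uniform continuity on the compact parameter set disposes of the unknown \<open>\<theta>\<close>.
\<close>

lemma derivative_along_density_flow:
  fixes u :: "real ^ 'd \<Rightarrow> (real ^ 'd \<Rightarrow> real) \<Rightarrow> real \<Rightarrow> real"
  assumes \<rho>D: "\<And>r. r \<in> {t..T} \<Longrightarrow> \<rho> r \<in> densities" and \<rho>: "C1_time {t..T} \<rho> \<rho>'" and s: "s \<in> {t..T}"
    and ut: "((\<lambda>r. u x (\<rho> s) r) has_real_derivative u'x) (at s within {..T})"
    and fv: "\<And>\<mu> r. \<mu> \<in> densities \<Longrightarrow> r \<le> T \<Longrightarrow> first_variation (\<lambda>\<mu>. u x \<mu> r) \<mu> (\<lambda>y. du x \<mu> y r)"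
    and jc: "jointly_continuous T (\<lambda>x \<rho> y s. du x \<rho> y s)"
  shows "((\<lambda>r. u x (\<rho> r) r) has_real_derivative
           u'x + integral torus_cell (\<lambda>y. du x (\<rho> s) y s * \<rho>' s y)) (at s within {t..T})"
proof -
  let ?I = "{t..T}"
  have ct\<rho>: "continuous_on (?I \<times> UNIV) (\<lambda>(s, x). \<rho> s x)"
    and der\<rho>: "\<And>s y. s \<in> ?I \<Longrightarrow> ((\<lambda>r. \<rho> r y) has_real_derivative \<rho>' s y) (at s within ?I)"
    and ct\<rho>': "continuous_on (?I \<times> UNIV) (\<lambda>(s, x). \<rho>' s x)"
    using \<rho> by (auto simp: C1_time_def)
  \<comment> \<open>the difference quotient of \<open>\<rho>\<close>, extended by \<open>\<rho>' s\<close> to \<open>r = s\<close>\<close>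
  define q where "q r y = integral {0..1} (\<lambda>\<tau>. \<rho>' (s + \<tau> * (r - s)) y)" for r y
  have q: "\<rho> r y - \<rho> s y = (r - s) * q r y" if "r \<in> ?I" for r y
    unfolding q_def by (rule increment_eq_mean_derivative[OF der\<rho> s that ct\<rho>'])
  have in': "s + \<tau> * (r - s) \<in> ?I" if "\<tau> \<in> {0..1}" "r \<in> ?I" for \<tau> r
    using that s convexD_alt[of ?I s r \<tau>] by (simp add: algebra_simps)
  have cq: "continuous_on (?I \<times> UNIV) (\<lambda>(r, y). q r y)"
    unfolding q_def case_prod_beta box_real(2)[symmetric]
  proof (rule integral_continuous_on_param, unfold case_prod_beta)
    show "continuous_on ((cbox t T \<times> UNIV) \<times> cbox 0 1)
       (\<lambda>p. \<rho>' (s + snd p * (fst (fst p) - s)) (snd (fst p)))"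
      by (rule continuous_on_compose_curried[OF ct\<rho>']) (use in' in \<open>auto intro!: continuous_intros\<close>)
  qed
  define \<sigma> where "\<sigma> p y = \<rho> s y + snd p * (\<rho> (fst p) y - \<rho> s y)" for p :: "real \<times> real" and y
  define J where "J p = integral torus_cell (\<lambda>y. du x (\<sigma> p) y (fst p) * q (fst p) y)" for p :: "real \<times> real"
  have c1: "continuous_on ((?I \<times> {0..1}) \<times> UNIV) (\<lambda>(p, y). du x (\<sigma> p) y (fst p))"
    unfolding case_prod_beta
  proof (rule jointly_continuous_compose[OF jc])
    fix p :: "(real \<times> real) \<times> (real ^ 'd)" assume p: "p \<in> (?I \<times> {0..1}) \<times> UNIV"
    then show "fst (fst p) \<le> T" by auto
    show "\<sigma> (fst p) \<in> densities"
      unfolding \<sigma>_def using p s by (intro densities_convex \<rho>D) auto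
  next
    have "continuous_on (((?I \<times> {0..1}) \<times> UNIV) \<times> UNIV) (\<lambda>z. \<rho> (fst (fst (fst z))) (snd z))"
      by (rule continuous_on_compose_curried[OF ct\<rho>]) (auto intro!: continuous_intros)
    moreover have "continuous_on (((?I \<times> {0..1}) \<times> UNIV) \<times> UNIV) (\<lambda>z. \<rho> s (snd z))"
      by (rule continuous_on_compose_curried[OF ct\<rho>]) (use s in \<open>auto intro!: continuous_intros\<close>)
    ultimately show "continuous_on (((?I \<times> {0..1}) \<times> UNIV) \<times> UNIV) (\<lambda>(p, z). \<sigma> (fst p) z)"
      unfolding \<sigma>_def case_prod_beta by (intro continuous_intros)
    show "continuous_on ((?I \<times> {0..1}) \<times> UNIV) (\<lambda>p::(real \<times> real) \<times> (real ^ 'd). x)"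
      by (rule continuous_on_const)
    show "continuous_on ((?I \<times> {0..1}) \<times> UNIV) (\<lambda>p::(real \<times> real) \<times> (real ^ 'd). snd p)"
      by (intro continuous_intros)
    show "continuous_on ((?I \<times> {0..1}) \<times> UNIV) (\<lambda>p::(real \<times> real) \<times> (real ^ 'd). fst (fst p))"
      by (intro continuous_intros)
  qed
  have cJ: "continuous_on (?I \<times> {0..1}) J"
    unfolding J_def
  proof (rule integral_continuous_on_param, unfold case_prod_beta)
    have "continuous_on ((?I \<times> {0..1}) \<times> torus_cell) (\<lambda>z. du x (\<sigma> (fst z)) (snd z) (fst (fst z)))"
      using continuous_on_subset[OF c1, of "(?I \<times> {0..1}) \<times> torus_cell"] by (auto simp: case_prod_beta)
    moreover have "continuous_on ((?I \<times> {0..1}) \<times> torus_cell) (\<lambda>z. q (fst (fst z)) (snd z))"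
      by (rule continuous_on_compose_curried[OF cq]) (auto intro!: continuous_intros)
    ultimately show "continuous_on ((?I \<times> {0..1}) \<times> torus_cell)
        (\<lambda>z. du x (\<sigma> (fst z)) (snd z) (fst (fst z)) * q (fst (fst z)) (snd z))"
      by (intro continuous_intros)
  qed
  define J0 where "J0 = integral torus_cell (\<lambda>y. du x (\<rho> s) y s * \<rho>' s y)"
  have "\<sigma> (s, \<theta>) = \<rho> s" for \<theta> by (auto simp: \<sigma>_def)
  then have J0: "J (s, \<theta>) = J0" for \<theta> by (simp add: J_def J0_def q_def)
  have "\<exists>\<theta>\<in>{0..1}. u x (\<rho> r) r - u x (\<rho> s) r = (r - s) * J (r, \<theta>)" if r: "r \<in> ?I" for r
  proof -
    obtain \<theta> where \<theta>: "\<theta> \<in> {0..1}"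
      "u x (\<rho> r) r - u x (\<rho> s) r = integral torus_cell (\<lambda>y. du x (\<lambda>y. \<rho> s y + \<theta> * (\<rho> r y - \<rho> s y)) y r * (\<rho> r y - \<rho> s y))"
      using first_variation_mean_value[OF \<rho>D[OF s] \<rho>D[OF r], of "\<lambda>\<mu>. u x \<mu> r" "\<lambda>\<mu> y. du x \<mu> y r"] fv r by auto
    have \<sigma>: "(\<lambda>y. \<rho> s y + \<theta> * (\<rho> r y - \<rho> s y)) = \<sigma> (r, \<theta>)" by (simp add: \<sigma>_def fun_eq_iff)
    note \<theta>(2)
    also have "(\<lambda>y. du x (\<lambda>y. \<rho> s y + \<theta> * (\<rho> r y - \<rho> s y)) y r * (\<rho> r y - \<rho> s y)) =
        (\<lambda>y. (r - s) * (du x (\<sigma> (r, \<theta>)) y r * q r y))"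
      unfolding \<sigma> unfolding q[OF r] by (simp only: mult.left_commute)
    finally have "u x (\<rho> r) r - u x (\<rho> s) r = (r - s) * J (r, \<theta>)" by (simp add: J_def)
    with \<theta>(1) show ?thesis by blast
  qed
  then have "\<forall>r\<in>?I. \<exists>\<theta>. \<theta> \<in> {0..1} \<and> u x (\<rho> r) r - u x (\<rho> s) r = (r - s) * J (r, \<theta>)" by blast
  from bchoice[OF this] obtain \<Theta> where \<Theta>: "\<And>r. r \<in> ?I \<Longrightarrow>
      \<Theta> r \<in> {0..1} \<and> u x (\<rho> r) r - u x (\<rho> s) r = (r - s) * J (r, \<Theta> r)"
    by blast
  have limJ: "((\<lambda>r. J (r, \<Theta> r)) \<longlongrightarrow> J0) (at s within ?I)"
    unfolding Lim_within
  proof (intro allI impI)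
    fix e :: real assume e: "0 < e"
    have "uniformly_continuous_on (?I \<times> {0..1}) J"
      by (intro compact_uniformly_continuous cJ compact_Times) auto
    from this[unfolded uniformly_continuous_on_def, rule_format, OF e] obtain d where "0 < d"
      and d: "\<And>p p'. p \<in> ?I \<times> {0..1} \<Longrightarrow> p' \<in> ?I \<times> {0..1} \<Longrightarrow> dist p' p < d \<Longrightarrow> dist (J p') (J p) < e"
      by blast
    have "dist (J (r, \<Theta> r)) J0 < e" if "r \<in> ?I" "dist r s < d" for r
      using d[of "(s, \<Theta> r)" "(r, \<Theta> r)"] that s conjunct1[OF \<Theta>[of r]] by (auto simp: J0 dist_Pair_Pair)
    then show "\<exists>d>0. \<forall>r\<in>?I. 0 < dist r s \<and> dist r s < d \<longrightarrow> dist (J (r, \<Theta> r)) J0 < e"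
      using \<open>0 < d\<close> by blast
  qed
  have "((\<lambda>r. u x (\<rho> s) r) has_real_derivative u'x) (at s within ?I)"
    by (rule DERIV_subset[OF ut]) auto
  then have "((\<lambda>r. (u x (\<rho> s) r - u x (\<rho> s) s) / (r - s) + J (r, \<Theta> r)) \<longlongrightarrow> u'x + J0) (at s within ?I)"
    by (intro tendsto_add limJ) (simp add: has_field_derivative_iff)
  then have "((\<lambda>r. (u x (\<rho> r) r - u x (\<rho> s) s) / (r - s)) \<longlongrightarrow> u'x + J0) (at s within ?I)"
  proof (rule Lim_transform_within[OF _ zero_less_one])
    fix r assume r: "r \<in> ?I" "0 < dist r s"
    have "u x (\<rho> r) r - u x (\<rho> s) s = (u x (\<rho> s) r - u x (\<rho> s) s) + (r - s) * J (r, \<Theta> r)"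
      using \<Theta>[OF r(1)] by simp
    moreover have "r - s \<noteq> 0" using r by auto
    ultimately show "(u x (\<rho> s) r - u x (\<rho> s) s) / (r - s) + J (r, \<Theta> r) = (u x (\<rho> r) r - u x (\<rho> s) s) / (r - s)"
      by (simp only: add_divide_distrib nonzero_mult_div_cancel_left[OF \<open>r - s \<noteq> 0\<close>])
  qed
  then show ?thesis by (simp add: has_field_derivative_iff J0_def)
qed

section \<open>Verification for the Hamilton-Jacobi equation\<close>

lemma integer_translate_into_cell:
  fixes x :: "real ^ 'd"
  obtains k :: "real ^ 'd" where "\<forall>i. k $ i \<in> \<int>" "x + k \<in> torus_cell"
proof
  let ?k = "(\<chi> i. - of_int \<lfloor>x $ i\<rfloor>) :: real ^ 'd"
  show "\<forall>i. ?k $ i \<in> \<int>" by simp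
  have "0 \<le> x $ i - of_int \<lfloor>x $ i\<rfloor> \<and> x $ i - of_int \<lfloor>x $ i\<rfloor> \<le> 1" for i
    using floor_correct[of "x $ i"] by linarith
  then show "x + ?k \<in> torus_cell" by (simp add: mem_box_cart)
qed

lemma absolutely_integrable_append:
  fixes g h :: "real \<Rightarrow> 'a::euclidean_space"
  assumes g: "g absolutely_integrable_on {a..b}" and h: "h absolutely_integrable_on {b..c}" and abc: "a \<le> b" "b \<le> c"
    and k: "\<And>s. a \<le> s \<Longrightarrow> s \<le> b \<Longrightarrow> k s = g s" "\<And>s. b < s \<Longrightarrow> s \<le> c \<Longrightarrow> k s = h s"
  shows "k absolutely_integrable_on {a..c}" "integral {a..c} k = integral {a..b} g + integral {b..c} h"
proof -
  have 1: "k absolutely_integrable_on {a..b}"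
    by (rule absolutely_integrable_spike[OF g, of "{}"]) (use k in auto)
  have 2: "k absolutely_integrable_on {b..c}"
    by (rule absolutely_integrable_spike[OF h, of "{b}"]) (use k in auto)
  show 3: "k absolutely_integrable_on {a..c}"
    by (rule absolutely_integrable_on_combine[OF 1 2 abc])
  have "integral {a..b} k = integral {a..b} g"
    by (rule Henstock_Kurzweil_Integration.integral_cong) (use k in auto)
  moreover have "integral {b..c} k = integral {b..c} h"
    by (rule integral_spike[of "{b}"]) (use k in auto)
  moreover have "k integrable_on {a..c}" using 3 by (auto simp: absolutely_integrable_on_def)
  ultimately show "integral {a..c} k = integral {a..b} g + integral {b..c} h"
    using Henstock_Kurzweil_Integration.integral_combine[OF abc] by metis
qed

locale classical_hamilton_jacobi =
  fixes L :: "real ^ 'd \<Rightarrow> real ^ 'd \<Rightarrow> real" and t T :: real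
    and \<Phi> \<Phi>' f :: "real \<Rightarrow> real ^ 'd \<Rightarrow> real"
  assumes lagrangian: "lagrangian L"
    and C1_time: "C1_time {t..T} \<Phi> \<Phi>'"
    and C1_space: "C1_space {t..T} \<Phi>"
    and hamilton_jacobi: "\<And>s x. s \<in> {t..T} \<Longrightarrow> \<Phi>' s x + hamiltonian L x (grad (\<Phi> s) x) + f s x = 0"
begin

lemma along_curve:
  assumes ab: "t \<le> a" "a \<le> b" "b \<le> T" and v: "v absolutely_integrable_on {a..b}"
    and x: "\<And>s. s \<in> {a..b} \<Longrightarrow> x s = x\<^sub>0 + integral {a..s} v"
  shows "((\<lambda>s. \<Phi>' s (x s) + grad (\<Phi> s) (x s) \<bullet> v s) has_integral \<Phi> b (x b) - \<Phi> a (x a)) {a..b}"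
proof -
  have sub: "{a..b} \<subseteq> {t..T}" "{a..b} \<times> UNIV \<subseteq> {t..T} \<times> (UNIV :: (real ^ 'd) set)" using ab by auto
  note T = C1_time[unfolded C1_time_def] and S = C1_space[unfolded C1_space_def]
  show ?thesis
  proof (rule chain_rule_along_curve[OF \<open>a \<le> b\<close> _ _ _ _ v x])
    show "((\<lambda>r. \<Phi> r z) has_real_derivative \<Phi>' s z) (at s within {a..b})" if "s \<in> {a..b}" for s z
      using T that sub(1) by (blast intro: DERIV_subset)
    show "GDERIV (\<Phi> s) z :> grad (\<Phi> s) z" if "s \<in> {a..b}" for s z
      using S that sub(1) by blast
    show "continuous_on ({a..b} \<times> UNIV) (\<lambda>(s, z). \<Phi>' s z)"
      using T sub(2) by (blast intro: continuous_on_subset)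
    show "continuous_on ({a..b} \<times> UNIV) (\<lambda>(s, z). grad (\<Phi> s) z)"
      using S sub(2) by (blast intro: continuous_on_subset)
  qed auto
qed

text \<open>
  Along the curve, \<open>\<Phi>\<close> grows at rate \<open>\<Phi>' + grad \<Phi> \<bullet> v = - H - f + grad \<Phi> \<bullet> v\<close>, which the Fenchel-Young
  inequality bounds by \<open>L - f\<close>.
\<close>

lemma payoff_le_value:
  assumes tT: "t \<le> T" and v: "v absolutely_integrable_on {t..T}"
    and x: "\<And>s. s \<in> {t..T} \<Longrightarrow> x s = x\<^sub>0 + integral {t..s} v"
    and c: "(\<lambda>s. L (x s) (v s) - f s (x s)) integrable_on {t..T}"
  shows "\<Phi> T (x T) - integral {t..T} (\<lambda>s. L (x s) (v s) - f s (x s)) \<le> \<Phi> t x\<^sub>0"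
proof -
  have "\<Phi> T (x T) - \<Phi> t (x t) \<le> integral {t..T} (\<lambda>s. L (x s) (v s) - f s (x s))"
  proof (rule has_integral_le[OF along_curve[OF order_refl tT order_refl v x] integrable_integral[OF c]])
    fix s assume s: "s \<in> {t..T}"
    show "\<Phi>' s (x s) + grad (\<Phi> s) (x s) \<bullet> v s \<le> L (x s) (v s) - f s (x s)"
      using hamilton_jacobi[OF s, of "x s"] fenchel_young[OF lagrangian, of "v s" "grad (\<Phi> s) (x s)" "x s"]
      by (simp add: inner_commute)
  qed
  moreover have "x t = x\<^sub>0" using x[of t] tT by simp
  ultimately show ?thesis by simp
qed

definition feedback :: "real \<Rightarrow> real ^ 'd \<Rightarrow> real ^ 'd" where
  "feedback s x = velocity L x (grad (\<Phi> s) x)"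

text \<open>
  This is the defect in the Fenchel-Young inequality, which is the rate at which a curve with velocity
  \<open>v\<close> loses payoff compared with the optimum.
\<close>

definition young_gap :: "real \<Rightarrow> real ^ 'd \<Rightarrow> real ^ 'd \<Rightarrow> real" where
  "young_gap s x v = hamiltonian L x (grad (\<Phi> s) x) + L x v - v \<bullet> grad (\<Phi> s) x"

lemma young_gap_feedback: "young_gap s x (feedback s x) = 0"
  by (simp add: young_gap_def feedback_def hamiltonian_eq[OF lagrangian])

lemma continuous_grad:
  assumes "continuous_on P a" "continuous_on P b" "\<And>p. p \<in> P \<Longrightarrow> a p \<in> {t..T}"
  shows "continuous_on P (\<lambda>p. grad (\<Phi> (a p)) (b p))"
  using assms C1_space unfolding C1_space_def
  by (blast intro: continuous_on_compose_curried[of "{t..T} \<times> UNIV" "\<lambda>s. grad (\<Phi> s)" P a b])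

lemma continuous_feedback:
  assumes "continuous_on P a" "continuous_on P b" "\<And>p. p \<in> P \<Longrightarrow> a p \<in> {t..T}"
  shows "continuous_on P (\<lambda>p. feedback (a p) (b p))"
  unfolding feedback_def
  by (rule continuous_on_compose_curried[OF continuous_velocity[OF lagrangian] assms(2) continuous_grad[OF assms]]) auto

lemma continuous_hamiltonian_grad:
  assumes "continuous_on P a" "continuous_on P b" "\<And>p. p \<in> P \<Longrightarrow> a p \<in> {t..T}"
  shows "continuous_on P (\<lambda>p. hamiltonian L (b p) (grad (\<Phi> (a p)) (b p)))"
  by (rule continuous_on_compose_curried[OF continuous_hamiltonian[OF lagrangian] assms(2) continuous_grad[OF assms]]) auto

lemma continuous_young_gap:
  assumes "continuous_on P a" "continuous_on P b" "continuous_on P v" "\<And>p. p \<in> P \<Longrightarrow> a p \<in> {t..T}"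
  shows "continuous_on P (\<lambda>p. young_gap (a p) (b p) (v p))"
proof -
  have "continuous_on UNIV (\<lambda>(x, v). L x v)" using lagrangian by (simp add: lagrangian_def)
  then have "continuous_on P (\<lambda>p. L (b p) (v p))"
    by (rule continuous_on_compose_curried) (auto intro: assms)
  then show ?thesis
    unfolding young_gap_def by (intro continuous_intros continuous_hamiltonian_grad continuous_grad assms)
qed

lemma periodic:
  assumes s: "s \<in> {t..T}" and k: "\<forall>i. k $ i \<in> \<int>"
  shows "feedback s (x + k) = feedback s x" "young_gap s (x + k) v = young_gap s x v"
proof -
  have "torus_fun (grad (\<Phi> s))"
    using C1_time C1_space s unfolding C1_time_def C1_space_def by (intro grad_periodic) blast+
  then have "grad (\<Phi> s) (x + k) = grad (\<Phi> s) x" using k by (auto simp: torus_fun_def)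
  moreover have "velocity L (x + k) p = velocity L x p" "hamiltonian L (x + k) p = hamiltonian L x p" "L (x + k) v = L x v" for p
    using legendre_transform_periodic[OF lagrangian] lagrangian k unfolding torus_fun_def lagrangian_def by blast+
  ultimately show "feedback s (x + k) = feedback s x" "young_gap s (x + k) v = young_gap s x v"
    by (simp_all add: feedback_def young_gap_def)
qed

lemma feedback_bounded: "\<exists>M\<ge>0. \<forall>s\<in>{t..T}. \<forall>x. norm (feedback s x) \<le> M"
proof -
  have "bounded ((\<lambda>p. feedback (fst p) (snd p)) ` ({t..T} \<times> torus_cell))"
    by (rule compact_imp_bounded, rule compact_continuous_image, rule continuous_feedback)
       (auto intro!: continuous_intros compact_Times)
  then obtain M where M: "\<forall>z\<in>(\<lambda>p. feedback (fst p) (snd p)) ` ({t..T} \<times> torus_cell). norm z \<le> M"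
    unfolding bounded_iff by blast
  have "norm (feedback s x) \<le> max M 0" if s: "s \<in> {t..T}" for s x
  proof -
    obtain k where k: "\<forall>i. k $ i \<in> \<int>" "x + k \<in> torus_cell" by (rule integer_translate_into_cell)
    then have "norm (feedback s (x + k)) \<le> M" using M s by force
    then show ?thesis using periodic(1)[OF s k(1)] by simp
  qed
  then show ?thesis by (intro exI[of _ "max M 0"]) auto
qed

text \<open>
  A velocity that is optimal at \<open>(s, x)\<close> remains nearly optimal at nearby points, with a tolerance that
  does not depend on \<open>(s, x)\<close>. By periodicity \<open>x\<close> can be taken in the unit cell. Then \<open>z\<close>, at distance at
  most \<open>1\<close>, lies in a fixed larger box, and uniform continuity on a compact set applies.
\<close>

lemma young_gap_small:
  assumes e: "0 < e"
  shows "\<exists>d>0. \<forall>s\<in>{t..T}. \<forall>r\<in>{t..T}. \<forall>x z. dist (r, z) (s, x) < d \<longrightarrow> young_gap r z (feedback s x) < e"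
proof -
  let ?I = "{t..T}"
  let ?C = "(?I \<times> torus_cell) \<times> (?I \<times> cbox (- 1) (2 :: real ^ 'd))"
  let ?Q = "\<lambda>p. young_gap (fst (snd p)) (snd (snd p)) (feedback (fst (fst p)) (snd (fst p)))"
  have "uniformly_continuous_on ?C ?Q"
    by (rule compact_uniformly_continuous, rule continuous_young_gap)
       (auto intro!: continuous_intros continuous_feedback compact_Times)
  from this[unfolded uniformly_continuous_on_def, rule_format, OF e] obtain d where d0: "0 < d"
    and d: "\<And>p p'. p \<in> ?C \<Longrightarrow> p' \<in> ?C \<Longrightarrow> dist p' p < d \<Longrightarrow> dist (?Q p') (?Q p) < e"
    by blast
  have "young_gap r z (feedback s x) < e" if s: "s \<in> ?I" and r: "r \<in> ?I" and near: "dist (r, z) (s, x) < min d 1" for s r x z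
  proof -
    obtain k where k: "\<forall>i. k $ i \<in> \<int>" "x + k \<in> torus_cell" by (rule integer_translate_into_cell)
    have dz: "dist (r, z + k) (s, x + k) = dist (r, z) (s, x)" by (simp add: dist_Pair_Pair dist_norm)
    have "dist (z + k) (x + k) \<le> 1"
      using near dist_snd_le[of "(r, z)" "(s, x)"] by (simp add: dist_norm)
    then have "\<bar>(z + k) $ i - (x + k) $ i\<bar> \<le> 1" for i
      using component_le_norm_cart[of "z + k - (x + k)" i] by (simp add: dist_norm)
    moreover have "0 \<le> (x + k) $ i \<and> (x + k) $ i \<le> 1" for i using k(2) by (simp add: mem_box_cart)
    ultimately have "- 1 \<le> (z + k) $ i \<and> (z + k) $ i \<le> 2 \<and> - 1 \<le> (x + k) $ i \<and> (x + k) $ i \<le> 2" for i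
      by (smt (verit))
    then have box: "z + k \<in> cbox (- 1) 2" "x + k \<in> cbox (- 1) 2" by (simp_all add: mem_box_cart)
    have "dist ((s, x + k), (r, z + k)) ((s, x + k), (s, x + k)) = dist (r, z + k) (s, x + k)"
      by (simp only: dist_Pair_Pair[of "(s, x + k)" "(r, z + k)"] dist_self) simp
    then have "dist (?Q ((s, x + k), (r, z + k))) (?Q ((s, x + k), (s, x + k))) < e"
      using near k(2) s r box dz by (intro d) simp_all
    then show ?thesis
      using periodic[OF r k(1)] periodic[OF s k(1)] by (simp add: young_gap_feedback dist_real_def)
  qed
  then show ?thesis using d0 by (intro exI[of _ "min d 1"]) auto
qed

text \<open>
  Along a straight line the growth of \<open>\<Phi>\<close> is \<open>L - f\<close> minus the Fenchel-Young defect. The running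
  reward \<open>f\<close> is continuous along the line because the equation expresses it through \<open>\<Phi>'\<close> and the
  Hamiltonian.
\<close>

lemma euler_step:
  assumes ab: "t \<le> a" "a \<le> b" "b \<le> T" and y: "y = (\<lambda>s. x + (s - a) *\<^sub>R v)"
    and gap: "\<And>s. s \<in> {a..b} \<Longrightarrow> young_gap s (y s) v \<le> e"
  shows "(\<lambda>s. L (y s) v - f s (y s)) absolutely_integrable_on {a..b}"
    "\<Phi> a x - e * (b - a) \<le> \<Phi> b (y b) - integral {a..b} (\<lambda>s. L (y s) v - f s (y s))"
proof -
  let ?I = "{t..T}"
  have cy: "continuous_on {a..b} y" unfolding y by (intro continuous_intros)
  have cL: "continuous_on {a..b} (\<lambda>s. L (y s) v)"
    by (rule continuous_on_compose_curried[of UNIV L])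
       (use lagrangian cy in \<open>auto simp: lagrangian_def\<close>)
  have "continuous_on {a..b} (\<lambda>s. \<Phi>' s (y s))"
    by (rule continuous_on_compose_curried[of "?I \<times> UNIV" \<Phi>'])
       (use C1_time ab cy in \<open>auto simp: C1_time_def intro!: continuous_intros\<close>)
  moreover have "continuous_on {a..b} (\<lambda>s. hamiltonian L (y s) (grad (\<Phi> s) (y s)))"
    by (rule continuous_hamiltonian_grad) (use cy ab in \<open>auto intro!: continuous_intros\<close>)
  ultimately have "continuous_on {a..b} (\<lambda>s. - \<Phi>' s (y s) - hamiltonian L (y s) (grad (\<Phi> s) (y s)))"
    by (intro continuous_intros)
  moreover have feq: "f s (y s) = - \<Phi>' s (y s) - hamiltonian L (y s) (grad (\<Phi> s) (y s))" if "s \<in> {a..b}" for s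
    using hamilton_jacobi[of s "y s"] that ab by simp
  ultimately have "continuous_on {a..b} (\<lambda>s. f s (y s))"
    by (elim continuous_on_eq) simp
  then show *: "(\<lambda>s. L (y s) v - f s (y s)) absolutely_integrable_on {a..b}"
    by (intro absolutely_integrable_continuous_real continuous_intros cL)
  have h1: "((\<lambda>s. \<Phi>' s (y s) + grad (\<Phi> s) (y s) \<bullet> v) has_integral \<Phi> b (y b) - \<Phi> a (y a)) {a..b}"
    by (rule along_curve[OF ab, of _ _ x]) (auto simp: y absolutely_integrable_continuous_real)
  have h2: "((\<lambda>s. (L (y s) v - f s (y s)) - e) has_integral
      integral {a..b} (\<lambda>s. L (y s) v - f s (y s)) - e * (b - a)) {a..b}"
    using has_integral_const_real[of e a b] * ab
    by (intro has_integral_diff integrable_integral) (auto simp: absolutely_integrable_on_def mult.commute)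
  have "integral {a..b} (\<lambda>s. L (y s) v - f s (y s)) - e * (b - a) \<le> \<Phi> b (y b) - \<Phi> a (y a)"
  proof (rule has_integral_le[OF h2 h1])
    fix s assume s: "s \<in> {a..b}"
    show "(L (y s) v - f s (y s)) - e \<le> \<Phi>' s (y s) + grad (\<Phi> s) (y s) \<bullet> v"
      using gap[OF s] feq[OF s] by (simp add: young_gap_def inner_commute)
  qed
  then show "\<Phi> a x - e * (b - a) \<le> \<Phi> b (y b) - integral {a..b} (\<lambda>s. L (y s) v - f s (y s))"
    by (simp add: y)
qed

text \<open>
  The induction is on the number of steps of length \<open>\<delta>\<close> left until time \<open>T\<close>: one straight segment is
  followed by the polygon that the induction hypothesis gives for its end point. This is why the start
  \<open>(a, x)\<close> is arbitrary.
\<close>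

lemma euler_polygon:
  assumes \<delta>: "0 < \<delta>"
    and step: "\<And>a b s x. a \<in> {t..T} \<Longrightarrow> b \<in> {t..T} \<Longrightarrow> b - a \<le> \<delta> \<Longrightarrow> s \<in> {a..b} \<Longrightarrow>
        young_gap s (x + (s - a) *\<^sub>R feedback a x) (feedback a x) \<le> e"
  shows "t \<le> a \<Longrightarrow> a \<le> T \<Longrightarrow> T - a \<le> real n * \<delta> \<Longrightarrow>
    \<exists>v y. (v, y) \<in> admissible a T x \<and> (\<lambda>s. L (y s) (v s) - f s (y s)) absolutely_integrable_on {a..T} \<and>
      \<Phi> a x - e * (T - a) \<le> \<Phi> T (y T) - integral {a..T} (\<lambda>s. L (y s) (v s) - f s (y s))"
proof (induction n arbitrary: a x)
  case 0
  then have "a = T" by simp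
  moreover have "h absolutely_integrable_on {T..T}" for h :: "real \<Rightarrow> 'b::euclidean_space"
    by (rule absolutely_integrable_continuous_real) simp
  ultimately show ?case
    by (intro exI[of _ "\<lambda>_. 0"] exI[of _ "\<lambda>_. x"]) (auto simp: admissible_def)
next
  case (Suc n)
  define b where "b = min (a + \<delta>) T"
  have ab: "a \<le> b" "b \<le> T" "b - a \<le> \<delta>" "t \<le> b" "T - b \<le> real n * \<delta>"
    using Suc.prems \<delta> by (auto simp: b_def min_def algebra_simps)
  define v0 where "v0 = feedback a x"
  define y0 where "y0 = (\<lambda>s. x + (s - a) *\<^sub>R v0)"
  obtain v1 y1 where v1: "v1 absolutely_integrable_on {b..T}"
    and y1: "\<And>s. s \<in> {b..T} \<Longrightarrow> y1 s = y0 b + integral {b..s} v1"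
    and c1: "(\<lambda>s. L (y1 s) (v1 s) - f s (y1 s)) absolutely_integrable_on {b..T}"
    and g1: "\<Phi> b (y0 b) - e * (T - b) \<le> \<Phi> T (y1 T) - integral {b..T} (\<lambda>s. L (y1 s) (v1 s) - f s (y1 s))"
    using Suc.IH[OF ab(4,2,5), of "y0 b"] unfolding admissible_def by blast
  have "young_gap s (y0 s) v0 \<le> e" if "s \<in> {a..b}" for s
    unfolding y0_def v0_def by (rule step[of a b]) (use that ab Suc.prems in auto)
  note e0 = euler_step[OF Suc.prems(1) ab(1,2) y0_def this]
  define v where "v s = (if s \<le> b then v0 else v1 s)" for s
  define y where "y s = (if s \<le> b then y0 s else y1 s)" for s
  have v0i: "(\<lambda>_. v0) absolutely_integrable_on {a..s}" for s
    by (rule absolutely_integrable_continuous_real) simp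
  have v: "v absolutely_integrable_on {a..T}"
    by (rule absolutely_integrable_append[OF v0i v1 ab(1,2)]) (auto simp: v_def)
  have "y s = x + integral {a..s} v" if s: "s \<in> {a..T}" for s
  proof (cases "s \<le> b")
    case True
    then have "integral {a..s} v = integral {a..s} (\<lambda>_. v0)"
      by (intro Henstock_Kurzweil_Integration.integral_cong) (auto simp: v_def)
    then show ?thesis using True s by (simp add: y_def y0_def)
  next
    case False
    have "v1 absolutely_integrable_on {b..s}"
      by (rule set_integrable_subset[OF v1]) (use s in auto)
    then have "integral {a..s} v = integral {a..b} (\<lambda>_. v0) + integral {b..s} v1"
      using False by (intro absolutely_integrable_append[OF v0i _ ab(1)]) (auto simp: v_def)
    then show ?thesis using False s y1[of s] ab by (simp add: y_def y0_def)
  qed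
  with v have adm: "(v, y) \<in> admissible a T x" by (simp add: admissible_def)
  have c: "(\<lambda>s. L (y s) (v s) - f s (y s)) absolutely_integrable_on {a..T}"
    "integral {a..T} (\<lambda>s. L (y s) (v s) - f s (y s)) =
      integral {a..b} (\<lambda>s. L (y0 s) v0 - f s (y0 s)) + integral {b..T} (\<lambda>s. L (y1 s) (v1 s) - f s (y1 s))"
    by (rule absolutely_integrable_append[OF e0(1) c1 ab(1,2)]; simp add: v_def y_def)+
  have "y T = y1 T"
    using y1[of b] ab by (cases "T = b") (auto simp: y_def)
  then have "\<Phi> a x - e * (T - a) \<le> \<Phi> T (y T) - integral {a..T} (\<lambda>s. L (y s) (v s) - f s (y s))"
    using e0(2) g1 unfolding c(2) by (simp add: algebra_simps)
  with adm c(1) show ?case by blast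
qed

text \<open>
  The feedback velocity is merely continuous, so an exactly optimal curve would have to come from Peano's
  existence theorem. The supremum only needs nearly optimal curves, and Euler polygons are enough for
  that. As the feedback velocity is bounded by some \<open>M\<close>, during a step of length \<open>\<delta>\<close> the curve stays
  within \<open>\<delta> + \<delta> * M\<close> of the point where the velocity was chosen.
\<close>

lemma nearly_optimal_curve:
  assumes tT: "t \<le> T" and e: "0 < e"
  shows "\<exists>v y. (v, y) \<in> admissible t T x \<and> (\<lambda>s. L (y s) (v s) - f s (y s)) absolutely_integrable_on {t..T} \<and>
      \<Phi> t x - e * (T - t) \<le> \<Phi> T (y T) - integral {t..T} (\<lambda>s. L (y s) (v s) - f s (y s))"
proof -
  obtain M where M0: "0 \<le> M" and M: "\<And>s x. s \<in> {t..T} \<Longrightarrow> norm (feedback s x) \<le> M"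
    using feedback_bounded by blast
  obtain d where d0: "0 < d" and d: "\<And>s r x z. s \<in> {t..T} \<Longrightarrow> r \<in> {t..T} \<Longrightarrow> dist (r, z) (s, x) < d \<Longrightarrow>
      young_gap r z (feedback s x) < e"
    using young_gap_small[OF e] by blast
  define \<delta> where "\<delta> = d / (2 * (1 + M))"
  have \<delta>0: "0 < \<delta>" using d0 M0 by (simp add: \<delta>_def)
  have \<delta>M: "\<delta> + \<delta> * M < d"
  proof -
    have "\<delta> + \<delta> * M = \<delta> * (1 + M)" by (simp add: algebra_simps)
    also have "\<dots> = d / 2" using M0 by (simp add: \<delta>_def field_simps)
    finally show ?thesis using d0 by simp
  qed
  obtain n where n: "T - t \<le> real n * \<delta>"
    using reals_Archimedean3[OF \<delta>0] less_imp_le by blast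
  show ?thesis
  proof (rule euler_polygon[OF \<delta>0 _ order_refl tT n])
    fix a b s x assume a: "a \<in> {t..T}" and b: "b \<in> {t..T}" "b - a \<le> \<delta>" and s: "s \<in> {a..b}"
    have "dist (s, x + (s - a) *\<^sub>R feedback a x) (a, x) \<le> \<bar>s - a\<bar> + norm ((s - a) *\<^sub>R feedback a x)"
      using norm_Pair_le[of "s - a" "(s - a) *\<^sub>R feedback a x"] by (simp add: dist_norm)
    also have "\<dots> = (s - a) + (s - a) * norm (feedback a x)" using s by simp
    also have "\<dots> \<le> \<delta> + \<delta> * M"
      using s b M[OF a, of x] \<delta>0 by (intro add_mono mult_mono) auto
    also have "\<dots> < d" by (rule \<delta>M)
    finally show "young_gap s (x + (s - a) *\<^sub>R feedback a x) (feedback a x) \<le> e"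
      using d[of a s] a b s by force
  qed
qed

end

section \<open>The master equation along the mean field game flow\<close>

lemma jointly_continuous_along_flow:
  fixes f :: "real ^ 'd \<Rightarrow> (real ^ 'd \<Rightarrow> real) \<Rightarrow> real ^ 'd \<Rightarrow> real \<Rightarrow> 'b::topological_space"
    and P :: "'p::{first_countable_topology, t2_space} set"
  assumes jc: "jointly_continuous T f"
    and \<rho>D: "\<And>s. s \<in> {t..T} \<Longrightarrow> \<rho> s \<in> densities" and \<rho>: "continuous_on ({t..T} \<times> UNIV) (\<lambda>(s, x). \<rho> s x)"
    and P: "continuous_on P a" "continuous_on P b" "continuous_on P c" "\<And>p. p \<in> P \<Longrightarrow> a p \<in> {t..T}"
  shows "continuous_on P (\<lambda>p. f (b p) (\<rho> (a p)) (c p) (a p))"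
proof (rule jointly_continuous_compose[OF jc])
  have "continuous_on (P \<times> UNIV) (\<lambda>p. a (fst p))"
    by (rule continuous_on_compose2[OF P(1)]) (auto intro!: continuous_intros)
  then show "continuous_on (P \<times> UNIV) (\<lambda>(p, z). \<rho> (a p) z)"
    unfolding case_prod_beta
    by (rule continuous_on_compose_curried[OF \<rho>]) (auto intro!: continuous_intros dest!: P(4))
qed (use P \<rho>D in auto)

text \<open>
  The density moves with the velocity given by \<open>\<Phi>\<close>, whereas the transport term of the master equation
  uses the velocity given by \<open>u\<close>. The time derivative of \<open>u x (\<rho> s) s\<close> is \<open>u'\<close> plus the integral of \<open>du\<close>
  against \<open>\<rho>'\<close>; by the continuity equation and integration by parts, that integral is the transport term
  built from \<open>\<Phi>\<close>. Substituting the master equation for \<open>u'\<close> leaves this term, together with \<open>- F\<close>, on the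
  right-hand side, and it can serve as a prescribed forcing because \<open>\<rho>\<close>, \<open>\<Phi>\<close> and \<open>du\<close> are given.
\<close>

lemma master_solution_along_flow:
  assumes L: "lagrangian L" and mfg: "mfg_solution L F G t T \<rho>\<^sub>0 \<rho> \<Phi>" and master: "master_solution L F G T u du"
    and tT: "t \<le> T"
  shows "nonlocal_hj_solution L G t T \<rho> du
    (\<lambda>x s. transport_term L (\<rho> s) (\<Phi> s) (\<lambda>y. du x (\<rho> s) y s) - F x (\<rho> s)) (\<lambda>s x. u x (\<rho> s) s)"
proof -
  let ?I = "{t..T}"
  define flux where "flux = (\<lambda>s x. \<rho> s x *\<^sub>R DpH L x (grad (\<Phi> s) x))"
  obtain \<rho>' \<Phi>' where \<rho>D: "\<And>s. s \<in> ?I \<Longrightarrow> \<rho> s \<in> densities"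
    and C1\<rho>: "C1_time ?I \<rho> \<rho>'" and C1\<Phi>: "C1_time ?I \<Phi> \<Phi>'" "C1_space ?I \<Phi>"
    and dflux: "\<And>s x. s \<in> ?I \<Longrightarrow> flux s differentiable (at x)"
    and cflux: "\<And>h. continuous_on (?I \<times> UNIV) (\<lambda>(s, x). frechet_derivative (flux s) (at x) h)"
    and continuity: "\<And>s x. s \<in> ?I \<Longrightarrow> \<rho>' s x + divergence (flux s) x = 0"
    using mfg unfolding mfg_solution_def Let_def
    by (elim exE conjE) (rule that; unfold flux_def; (assumption | blast))
  have c\<rho>: "continuous_on (?I \<times> UNIV) (\<lambda>(s, x). \<rho> s x)" and c\<rho>': "continuous_on (?I \<times> UNIV) (\<lambda>(s, x). \<rho>' s x)"
    using C1\<rho> by (auto simp: C1_time_def)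
  obtain u' where up: "\<And>\<mu> s. \<mu> \<in> densities \<Longrightarrow> s \<le> T \<Longrightarrow> torus_fun (\<lambda>x. u x \<mu> s)"
    and ut: "\<And>x \<mu> s. \<mu> \<in> densities \<Longrightarrow> s \<le> T \<Longrightarrow> ((\<lambda>r. u x \<mu> r) has_real_derivative u' x \<mu> s) (at s within {..T})"
    and ux: "\<And>x \<mu> s. \<mu> \<in> densities \<Longrightarrow> s \<le> T \<Longrightarrow> GDERIV (\<lambda>x. u x \<mu> s) x :> grad (\<lambda>x. u x \<mu> s) x"
    and fv: "\<And>x \<mu> s. \<mu> \<in> densities \<Longrightarrow> s \<le> T \<Longrightarrow> first_variation (\<lambda>\<mu>. u x \<mu> s) \<mu> (\<lambda>y. du x \<mu> y s)"
    and duy: "\<And>x \<mu> s y. \<mu> \<in> densities \<Longrightarrow> s \<le> T \<Longrightarrow> GDERIV (\<lambda>y. du x \<mu> y s) y :> grad (\<lambda>y. du x \<mu> y s) y"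
    and jc: "jointly_continuous T (\<lambda>x \<rho> y s. u x \<rho> s)" "jointly_continuous T (\<lambda>x \<rho> y s. u' x \<rho> s)"
      "jointly_continuous T (\<lambda>x \<rho> y s. grad (\<lambda>x. u x \<rho> s) x)" "jointly_continuous T (\<lambda>x \<rho> y s. du x \<rho> y s)"
      "jointly_continuous T (\<lambda>x \<rho> y s. grad (\<lambda>y. du x \<rho> y s) y)"
    and eqn: "\<And>x \<mu> s. \<mu> \<in> densities \<Longrightarrow> s \<le> T \<Longrightarrow> u' x \<mu> s + hamiltonian L x (grad (\<lambda>x. u x \<mu> s) x) + F x \<mu>
             + transport_term L \<mu> (\<lambda>y. u y \<mu> s) (\<lambda>y. du x \<mu> y s) = 0"
    and uT: "\<And>x \<mu>. \<mu> \<in> densities \<Longrightarrow> u x \<mu> T = G x \<mu>"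
    using master unfolding master_solution_def
    by (elim exE conjE) (rule that; (assumption | blast))
  note flow = jointly_continuous_along_flow[OF _ \<rho>D c\<rho>]
  have transport: "integral torus_cell (\<lambda>y. du x (\<rho> s) y s * \<rho>' s y)
      = transport_term L (\<rho> s) (\<Phi> s) (\<lambda>y. du x (\<rho> s) y s)" if s: "s \<in> ?I" for s x
  proof -
    let ?V = "\<lambda>y. du x (\<rho> s) y s"
    have sT: "s \<le> T" using s by simp
    have "torus_fun (grad (\<Phi> s))"
      using C1\<Phi> s unfolding C1_time_def C1_space_def by (intro grad_periodic) blast+
    moreover have "torus_fun (\<rho> s)" using \<rho>D[OF s] by (simp add: densities_def)
    ultimately have per: "torus_fun (flux s)"
      using legendre_transform_periodic(3)[OF L] by (simp add: torus_fun_def flux_def)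
    have "integral torus_cell (\<lambda>y. ?V y * \<rho>' s y) = integral torus_cell (\<lambda>y. - (?V y * divergence (flux s) y))"
    proof (rule Henstock_Kurzweil_Integration.integral_cong)
      fix y
      have "\<rho>' s y = - divergence (flux s) y" using continuity[OF s, of y] by simp
      then show "?V y * \<rho>' s y = - (?V y * divergence (flux s) y)" by simp
    qed
    also have "\<dots> = - integral torus_cell (\<lambda>y. ?V y * divergence (flux s) y)" by simp
    also have "\<dots> = integral torus_cell (\<lambda>y. grad ?V y \<bullet> flux s y)"
    proof (subst cell_integration_by_parts)
      show "torus_fun ?V" using fv[OF \<rho>D[OF s] sT] unfolding first_variation_def by blast
      show "GDERIV ?V y :> grad ?V y" for y by (rule duy[OF \<rho>D[OF s] sT])
      show "continuous_on UNIV (grad ?V)"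
        using flow[OF jc(5), of UNIV "\<lambda>_. s" "\<lambda>_. x" "\<lambda>y. y"] s by simp
      show "continuous_on UNIV (\<lambda>y. frechet_derivative (flux s) (at y) h)" for h
        by (rule continuous_on_compose_curried[OF cflux[of h], of UNIV "\<lambda>_. s" "\<lambda>y. y"]) (use s in auto)
    qed (use per dflux[OF s] in auto)
    also have "\<dots> = transport_term L (\<rho> s) (\<Phi> s) ?V"
      unfolding transport_term_def flux_def by (simp add: inner_commute mult.commute)
    finally show ?thesis .
  qed
  define \<Psi>' where "\<Psi>' s x = u' x (\<rho> s) s + integral torus_cell (\<lambda>y. du x (\<rho> s) y s * \<rho>' s y)" for s x
  have "C1_time ?I (\<lambda>s x. u x (\<rho> s) s) \<Psi>'"
    unfolding C1_time_def
  proof (intro conjI ballI allI)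
    show "torus_fun (\<lambda>x. u x (\<rho> s) s)" if "s \<in> ?I" for s using up \<rho>D that by simp
    show "continuous_on (?I \<times> UNIV) (\<lambda>(s, x). u x (\<rho> s) s)"
      unfolding case_prod_beta by (rule flow[OF jc(1)]) (auto intro!: continuous_intros)
    show "((\<lambda>r. u x (\<rho> r) r) has_real_derivative \<Psi>' s x) (at s within ?I)" if "s \<in> ?I" for s x
      unfolding \<Psi>'_def
      by (rule derivative_along_density_flow[OF \<rho>D C1\<rho> that ut fv jc(4)]) (use that \<rho>D in auto)
    have "continuous_on (?I \<times> UNIV) (\<lambda>p. u' (snd p) (\<rho> (fst p)) (fst p))"
      by (rule flow[OF jc(2)]) (auto intro!: continuous_intros)
    moreover have "continuous_on (?I \<times> UNIV) (\<lambda>p. integral torus_cell (\<lambda>y. du (snd p) (\<rho> (fst p)) y (fst p) * \<rho>' (fst p) y))"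
    proof (rule integral_continuous_on_param, unfold case_prod_beta)
      let ?P = "(?I \<times> (UNIV :: (real ^ 'a) set)) \<times> (torus_cell :: (real ^ 'a) set)"
      have "continuous_on ?P (\<lambda>p. du (snd (fst p)) (\<rho> (fst (fst p))) (snd p) (fst (fst p)))"
        by (rule flow[OF jc(4)]) (auto intro!: continuous_intros)
      moreover have "continuous_on ?P (\<lambda>p. \<rho>' (fst (fst p)) (snd p))"
        by (rule continuous_on_compose_curried[OF c\<rho>']) (auto intro!: continuous_intros)
      ultimately show "continuous_on ?P (\<lambda>p. du (snd (fst p)) (\<rho> (fst (fst p))) (snd p) (fst (fst p)) * \<rho>' (fst (fst p)) (snd p))"
        by (rule continuous_on_mult)
    qed
    ultimately show "continuous_on (?I \<times> UNIV) (\<lambda>(s, x). \<Psi>' s x)"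
      unfolding \<Psi>'_def case_prod_beta by (rule continuous_on_add)
  qed
  moreover have "C1_space ?I (\<lambda>s x. u x (\<rho> s) s)"
    unfolding C1_space_def
  proof (intro conjI ballI allI)
    show "GDERIV (\<lambda>x. u x (\<rho> s) s) x :> grad (\<lambda>x. u x (\<rho> s) s) x" if "s \<in> ?I" for s x
      using ux \<rho>D that by simp
    show "continuous_on (?I \<times> UNIV) (\<lambda>(s, x). grad (\<lambda>x. u x (\<rho> s) s) x)"
      unfolding case_prod_beta by (rule flow[OF jc(3)]) (auto intro!: continuous_intros)
  qed
  moreover have "\<Psi>' s x + hamiltonian L x (grad (\<lambda>x. u x (\<rho> s) s) x)
      + transport_term L (\<rho> s) (\<lambda>y. u y (\<rho> s) s) (\<lambda>y. du x (\<rho> s) y s)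
      = transport_term L (\<rho> s) (\<Phi> s) (\<lambda>y. du x (\<rho> s) y s) - F x (\<rho> s)" if s: "s \<in> ?I" for s x
    using eqn[OF \<rho>D[OF s], of s x] s unfolding \<Psi>'_def transport[OF s] by simp
  moreover have "u x (\<rho> T) T = G x (\<rho> T)" for x using uT \<rho>D tT by simp
  ultimately show ?thesis unfolding nonlocal_hj_solution_def by blast
qed

text \<open>
  Adding the transport term built from \<open>\<Phi>\<close> to both sides of the Hamilton-Jacobi equation for \<open>\<Phi>\<close> produces
  the same forcing as for \<open>u x (\<rho> s) s\<close>.
\<close>

lemma mfg_value_solves_nonlocal:
  assumes "mfg_solution L F G t T \<rho>\<^sub>0 \<rho> \<Phi>"
  shows "nonlocal_hj_solution L G t T \<rho> du
    (\<lambda>x s. transport_term L (\<rho> s) (\<Phi> s) (\<lambda>y. du x (\<rho> s) y s) - F x (\<rho> s)) \<Phi>"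
proof -
  obtain \<rho>' \<Phi>' where "C1_time {t..T} \<Phi> \<Phi>'" "C1_space {t..T} \<Phi>"
    and "\<forall>s\<in>{t..T}. \<forall>x. \<Phi>' s x + hamiltonian L x (grad (\<Phi> s) x) + F x (\<rho> s) = 0"
    and "\<forall>x. \<Phi> T x = G x (\<rho> T)"
    using assms unfolding mfg_solution_def Let_def by blast
  then show ?thesis
    unfolding nonlocal_hj_solution_def by (intro exI[of _ \<Phi>']) (auto simp: algebra_simps eq_neg_iff_add_eq_0)
qed

lemma mfg_value_function:
  assumes L: "lagrangian L" and mfg: "mfg_solution L F G t T \<rho>\<^sub>0 \<rho> \<Phi>" and tT: "t \<le> T"
  shows "ereal (\<Phi> t x\<^sub>0) = (SUP (v, x) \<in> admissible t T x\<^sub>0. payoff L F G t T \<rho> v x)"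
proof -
  obtain \<rho>' \<Phi>' where C1: "C1_time {t..T} \<Phi> \<Phi>'" "C1_space {t..T} \<Phi>"
    and hj: "\<And>s x. s \<in> {t..T} \<Longrightarrow> \<Phi>' s x + hamiltonian L x (grad (\<Phi> s) x) + F x (\<rho> s) = 0"
    and \<Phi>T: "\<And>x. \<Phi> T x = G x (\<rho> T)"
    using mfg unfolding mfg_solution_def Let_def by blast
  interpret classical_hamilton_jacobi L t T \<Phi> \<Phi>' "\<lambda>s x. F x (\<rho> s)"
    by unfold_locales (use L C1 hj in auto)
  show ?thesis
  proof (rule antisym)
    show "(SUP (v, x) \<in> admissible t T x\<^sub>0. payoff L F G t T \<rho> v x) \<le> ereal (\<Phi> t x\<^sub>0)"
    proof (rule SUP_least, clarify)
      fix v x assume "(v, x) \<in> admissible t T x\<^sub>0"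
      then have v: "v absolutely_integrable_on {t..T}" and x: "\<And>s. s \<in> {t..T} \<Longrightarrow> x s = x\<^sub>0 + integral {t..s} v"
        by (auto simp: admissible_def)
      show "payoff L F G t T \<rho> v x \<le> ereal (\<Phi> t x\<^sub>0)"
        using payoff_le_value[OF tT v x] by (auto simp: payoff_def \<Phi>T absolutely_integrable_on_def)
    qed
    show "ereal (\<Phi> t x\<^sub>0) \<le> (SUP (v, x) \<in> admissible t T x\<^sub>0. payoff L F G t T \<rho> v x)"
    proof (rule ereal_le_epsilon2)
      fix e :: real assume e: "0 < e"
      \<comment> \<open>the added \<open>1\<close> keeps the denominator positive when \<open>T = t\<close>\<close>
      define e' where "e' = e / (T - t + 1)"
      have e': "0 < e'" "e' * (T - t) \<le> e" using e tT by (auto simp: e'_def field_simps)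
      obtain v x where vx: "(v, x) \<in> admissible t T x\<^sub>0"
        and ai: "(\<lambda>s. L (x s) (v s) - F (x s) (\<rho> s)) absolutely_integrable_on {t..T}"
        and le: "\<Phi> t x\<^sub>0 - e' * (T - t) \<le> \<Phi> T (x T) - integral {t..T} (\<lambda>s. L (x s) (v s) - F (x s) (\<rho> s))"
        using nearly_optimal_curve[OF tT e'(1)] by blast
      have "ereal (\<Phi> t x\<^sub>0) \<le> payoff L F G t T \<rho> v x + ereal e"
        using ai le e' by (simp add: payoff_def \<Phi>T)
      also have "\<dots> \<le> (SUP (v, x) \<in> admissible t T x\<^sub>0. payoff L F G t T \<rho> v x) + ereal e"
        using vx by (intro add_right_mono SUP_upper2[of "(v, x)"]) auto
      finally show "ereal (\<Phi> t x\<^sub>0) \<le> (SUP (v, x) \<in> admissible t T x\<^sub>0. payoff L F G t T \<rho> v x) + ereal e" .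
    qed
  qed
qed

theorem proposition2p9:
  fixes L :: "real ^ 'd \<Rightarrow> real ^ 'd \<Rightarrow> real"
    and F G :: "real ^ 'd \<Rightarrow> (real ^ 'd \<Rightarrow> real) \<Rightarrow> real"
    and t T :: real
    and \<rho>\<^sub>0 :: "real ^ 'd \<Rightarrow> real"
    and \<rho> \<Phi> :: "real \<Rightarrow> real ^ 'd \<Rightarrow> real"
    and u :: "real ^ 'd \<Rightarrow> (real ^ 'd \<Rightarrow> real) \<Rightarrow> real \<Rightarrow> real"
    and du :: "real ^ 'd \<Rightarrow> (real ^ 'd \<Rightarrow> real) \<Rightarrow> real ^ 'd \<Rightarrow> real \<Rightarrow> real"
  assumes L: "lagrangian L"
    and F: "\<forall>\<mu>\<in>densities. torus_fun (\<lambda>x. F x \<mu>)"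
    and G: "\<forall>\<mu>\<in>densities. torus_fun (\<lambda>x. G x \<mu>)"
    and t: "t \<le> T"
    and \<rho>\<^sub>0: "\<rho>\<^sub>0 \<in> densities"
    and mfg: "mfg_solution L F G t T \<rho>\<^sub>0 \<rho> \<Phi>"
    and master: "master_solution L F G T u du"
    and unique: "\<And>R \<Psi>\<^sub>1 \<Psi>\<^sub>2. nonlocal_hj_solution L G t T \<rho> du R \<Psi>\<^sub>1 \<Longrightarrow>
        nonlocal_hj_solution L G t T \<rho> du R \<Psi>\<^sub>2 \<Longrightarrow> \<forall>s\<in>{t..T}. \<forall>x. \<Psi>\<^sub>1 s x = \<Psi>\<^sub>2 s x"
  shows "\<forall>x\<^sub>0. ereal (u x\<^sub>0 \<rho>\<^sub>0 t) = (SUP (v, x) \<in> admissible t T x\<^sub>0. payoff L F G t T \<rho> v x)"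
proof
  fix x\<^sub>0
  have "u x\<^sub>0 (\<rho> t) t = \<Phi> t x\<^sub>0"
    using unique[OF master_solution_along_flow[OF L mfg master t] mfg_value_solves_nonlocal[OF mfg]] t by simp
  moreover have "\<rho> t = \<rho>\<^sub>0" using mfg by (auto simp: mfg_solution_def Let_def)
  ultimately show "ereal (u x\<^sub>0 \<rho>\<^sub>0 t) = (SUP (v, x) \<in> admissible t T x\<^sub>0. payoff L F G t T \<rho> v x)"
    using mfg_value_function[OF L mfg t, of x\<^sub>0] by simp
qed

end
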